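(* Let $0<p<\lambda<1$ and consider the queue at the cavity of the resource pooling policy with phase-type job sizes of mean $1$. (1) If $\frac{1}{1+\lambda/(1-p)}>\frac{1-\lambda}{1-p}$, then the maximum queue length is unbounded as a function of the job size distribution: for every $n\in\mathbb N$ there is a mean-one phase-type job size distribution for which the maximum queue length exceeds $n$. (2) Otherwise, the stationary queue length distribution of the queue at the cavity is insensitive to the job size distribution (it is the same for every mean-one phase-type distribution) and the maximum queue length equals $1$.
   Context: A phase-type (PH) distribution $(\alpha,S)$ has $\alpha$ a probability row vector of length $n_s$, $S$ an invertible $n_s\times n_s$ subgenerator matrix, $s^*=-S\mathbf 1$ ($\mathbf 1$ the all-ones column), and mean $\alpha(-S)^{-1}\mathbf 1$. Resource pooling chain: for an integer $m\ge0$ and $\omega\ge0$, consider the continuous-time Markov chain on the states $0$ and $(q,j)$, $1\le q\le m+1$, $1\le j\le n_s$ ($q$ = queue length, $j$ = service phase), with transitions: $0\to(1,j)$ at rate $\lambda\alpha_j$; $(q,j)\to(q+1,j)$ at rate $\lambda$ for $1\le q\le m$; $(q,j)\to(q,j')$ at rate $(1-p)S_{jj'}$ for $j\ne j'$; $(q,j)\to(q-1,j')$ at rate $(1-p)s_j^*\alpha_{j'}$ for $2\le q\le m+1$; $(1,j)\to0$ at rate $(1-p)s^*_j$; and additionally, at rate $\omega$, $(m+1,j)\to(m,j)$ if $m\ge1$, respectively $(1,j)\to0$ if $m=0$. Let $\pi_0(m,\omega)$ be the stationary probability of state $0$. The queue at the cavity of the resource pooling policy is the stationary chain for the unique pair $(m,\omega)$,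 $m\in\{0,1,\dots\}$, $\omega\in[0,\infty)$, with $\pi_0(m,\omega)=\frac{1-\lambda}{1-p}$. Its maximum queue length is $m+1$. *)

theory Defs
  imports
    "HOL-Probability.Probability_Mass_Function"
    "Jordan_Normal_Form.Gauss_Jordan_Elimination"
begin

unbundle no vec_syntax
no_notation inner (infix "\<bullet>" 70)

section \<open>Phase-type distributions\<close>

text \<open>Phases are numbered from \<open>0\<close> to \<open>dim_vec \<alpha> - 1\<close>.\<close>

abbreviation ones_vec :: "nat \<Rightarrow> real vec" where
  "ones_vec n \<equiv> vec n (\<lambda>_. 1)"

definition probability_vec :: "real vec \<Rightarrow> bool" where
  "probability_vec \<alpha> \<longleftrightarrow>
     (\<forall>j < dim_vec \<alpha>. 0 \<le> \<alpha> $ j) \<and> (\<Sum>j < dim_vec \<alpha>. \<alpha> $ j) = 1"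

text \<open>Nonpositivity of the diagonal is implied by the two conditions on the entries.\<close>

definition subgenerator_mat :: "real mat \<Rightarrow> bool" where
  "subgenerator_mat S \<longleftrightarrow> square_mat S \<and>
     (\<forall>i < dim_row S. \<forall>j < dim_row S. i \<noteq> j \<longrightarrow> 0 \<le> S $$ (i, j)) \<and>
     (\<forall>i < dim_row S. (\<Sum>j < dim_row S. S $$ (i, j)) \<le> 0)"

definition phase_type :: "real vec \<Rightarrow> real mat \<Rightarrow> bool" where
  "phase_type \<alpha> S \<longleftrightarrow>
     dim_row S = dim_vec \<alpha> \<and> probability_vec \<alpha> \<and> subgenerator_mat S \<and> invertible_mat S"

definition exit_vec :: "real mat \<Rightarrow> real vec" where
  "exit_vec S = - (S *\<^sub>v ones_vec (dim_row S))"

text \<open>The mean is \<open>\<alpha> (-S)\<inverse> 1\<close>; \<open>mat_inverse\<close> returns \<open>Some\<close> of the inverse,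
  because \<open>S\<close> is invertible for every phase-type distribution.\<close>

definition ph_mean :: "real vec \<Rightarrow> real mat \<Rightarrow> real" where
  "ph_mean \<alpha> S = \<alpha> \<bullet> (the (mat_inverse (- S)) *\<^sub>v ones_vec (dim_row S))"

definition mean_one_phase_type :: "real vec \<Rightarrow> real mat \<Rightarrow> bool" where
  "mean_one_phase_type \<alpha> S \<longleftrightarrow> phase_type \<alpha> S \<and> ph_mean \<alpha> S = 1"

section \<open>Stationary distributions of finite continuous-time Markov chains\<close>

text \<open>Global balance on the finite state space \<open>X\<close>, where \<open>r x y\<close> is the rate of the
  transitions from \<open>x\<close> to \<open>y\<close>, for \<open>x \<noteq> y\<close>.\<close>

definition stationary_distribution :: "'s set \<Rightarrow> ('s \<Rightarrow> 's \<Rightarrow> real) \<Rightarrow> 's pmf \<Rightarrow> bool" where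
  "stationary_distribution X r \<pi> \<longleftrightarrow> set_pmf \<pi> \<subseteq> X \<and>
     (\<forall>y \<in> X. (\<Sum>x \<in> X - {y}. pmf \<pi> x * r x y) = pmf \<pi> y * (\<Sum>z \<in> X - {y}. r y z))"

section \<open>The resource pooling chain\<close>

text \<open>\<open>Busy q j\<close> is the state with queue length \<open>q\<close> and service phase \<open>j\<close>.\<close>

datatype rp_state = Empty | Busy nat nat

fun queue_length :: "rp_state \<Rightarrow> nat" where
  "queue_length Empty = 0"
| "queue_length (Busy q j) = q"

definition rp_states :: "nat \<Rightarrow> nat \<Rightarrow> rp_state set" where
  "rp_states n m = insert Empty {Busy q j | q j. 1 \<le> q \<and> q \<le> m + 1 \<and> j < n}"

text \<open>The summands are the different kinds of transitions: their rates add up when two kinds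
  connect the same pair of states, as for service completions and pooling at \<open>q = m + 1\<close>.\<close>

fun rp_rate ::
  "real \<Rightarrow> real \<Rightarrow> real vec \<Rightarrow> real mat \<Rightarrow> nat \<Rightarrow> real \<Rightarrow> rp_state \<Rightarrow> rp_state \<Rightarrow> real"
where
  "rp_rate lam p \<alpha> S m \<omega> Empty Empty = 0"
| "rp_rate lam p \<alpha> S m \<omega> Empty (Busy q j) = (if q = 1 then lam * \<alpha> $ j else 0)"
| "rp_rate lam p \<alpha> S m \<omega> (Busy q j) Empty =
     (if q = 1 then (1 - p) * exit_vec S $ j else 0) +
     (if q = 1 \<and> m = 0 then \<omega> else 0)"
| "rp_rate lam p \<alpha> S m \<omega> (Busy q j) (Busy q' j') =
     (if q \<le> m \<and> q' = q + 1 \<and> j' = j then lam else 0) +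
     (if q' = q \<and> j' \<noteq> j then (1 - p) * S $$ (j, j') else 0) +
     (if 2 \<le> q \<and> q' = q - 1 then (1 - p) * exit_vec S $ j * \<alpha> $ j' else 0) +
     (if 1 \<le> m \<and> q = m + 1 \<and> q' = m \<and> j' = j then \<omega> else 0)"

definition rp_stationary ::
  "real \<Rightarrow> real \<Rightarrow> real vec \<Rightarrow> real mat \<Rightarrow> nat \<Rightarrow> real \<Rightarrow> rp_state pmf"
where
  "rp_stationary lam p \<alpha> S m \<omega> =
     (THE \<pi>. stationary_distribution (rp_states (dim_vec \<alpha>) m) (rp_rate lam p \<alpha> S m \<omega>) \<pi>)"

section \<open>The queue at the cavity\<close>

definition cavity_params :: "real \<Rightarrow> real \<Rightarrow> real vec \<Rightarrow> real mat \<Rightarrow> nat \<times> real" where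
  "cavity_params lam p \<alpha> S =
     (THE (m, \<omega>). 0 \<le> \<omega> \<and> pmf (rp_stationary lam p \<alpha> S m \<omega>) Empty = (1 - lam) / (1 - p))"

definition cavity_stationary :: "real \<Rightarrow> real \<Rightarrow> real vec \<Rightarrow> real mat \<Rightarrow> rp_state pmf" where
  "cavity_stationary lam p \<alpha> S =
     (case cavity_params lam p \<alpha> S of (m, \<omega>) \<Rightarrow> rp_stationary lam p \<alpha> S m \<omega>)"

definition cavity_queue_length :: "real \<Rightarrow> real \<Rightarrow> real vec \<Rightarrow> real mat \<Rightarrow> nat pmf" where
  "cavity_queue_length lam p \<alpha> S = map_pmf queue_length (cavity_stationary lam p \<alpha> S)"

definition cavity_max_queue_length :: "real \<Rightarrow> real \<Rightarrow> real vec \<Rightarrow> real mat \<Rightarrow> nat" where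
  "cavity_max_queue_length lam p \<alpha> S = fst (cavity_params lam p \<alpha> S) + 1"

end

theory Submission
  imports Defs
begin

text \<open>
  Write \<open>idle m \<omega>\<close> for the stationary probability of the empty state. Expected times to empty the
  queue of one chain, used as test functions in the balance equations of another, compare the idle
  probabilities of chains with different parameters. They show that \<open>idle\<close> is continuous and strictly
  increasing in \<open>\<omega>\<close>, and that \<open>idle (m + 1) \<omega>\<close> stays below \<open>idle m 0\<close> and approaches it as \<open>\<omega>\<close> grows.
  Hence the pairs \<open>(m, \<omega>)\<close>, ordered by decreasing \<open>m\<close> and then increasing \<open>\<omega>\<close>, are mapped injectively
  and without gaps, and the value \<open>(1 - lam) / (1 - p)\<close> is attained exactly once.
  By Little's law \<open>idle 0 0 = 1 / (1 + lam / (1 - p))\<close> for every job size distribution of mean one. If the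
  target is at least this number, then \<open>m = 0\<close>, and the distribution of the queue length on
  \<open>{0, 1}\<close> is determined by the target. Otherwise take jobs that are very short with probability
  \<open>1 - \<epsilon>\<close> and have mean of order \<open>1 / \<epsilon>\<close> with probability \<open>\<epsilon>\<close>. As the jobs queueing behind a long
  one are short with high probability, \<open>idle n 0\<close> tends to \<open>idle 0 0\<close> as \<open>\<epsilon>\<close> tends to zero, for every fixed \<open>n\<close>.
  So \<open>idle n 0\<close> exceeds the target for small \<open>\<epsilon>\<close>, which forces \<open>m > n\<close>.
\<close>

section \<open>Finite Markov chains with an accessible root\<close>

text \<open>\<open>escape\<close> says, without paths, that the root is reachable from every state:
  the states that cannot reach it would form a set that is never left. Irreducibility would be too
  strong, because phases that no job visits give transient states.\<close>

locale rooted_chain =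
  fixes X :: "'s set" and r :: "'s \<Rightarrow> 's \<Rightarrow> real" and e :: 's
  assumes finite_states: "finite X"
    and root: "e \<in> X"
    and rate_nonneg: "\<And>x y. x \<in> X \<Longrightarrow> y \<in> X \<Longrightarrow> 0 \<le> r x y"
    and escape: "\<And>A. A \<subseteq> X - {e} \<Longrightarrow> A \<noteq> {} \<Longrightarrow> \<exists>x\<in>A. \<exists>y\<in>X - A. 0 < r x y"

text \<open>The summand at \<open>y = x\<close> vanishes, so self-loops cancel. This matters because
  \<open>eliminate\<close> turns a return through \<open>z\<close> into a self-loop.\<close>

definition generator :: "'s set \<Rightarrow> ('s \<Rightarrow> 's \<Rightarrow> real) \<Rightarrow> ('s \<Rightarrow> real) \<Rightarrow> 's \<Rightarrow> real" where
  "generator X r u x = (\<Sum>y\<in>X. r x y * (u y - u x))"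

text \<open>The rates of the chain watched only while it is outside \<open>z\<close>.\<close>

definition eliminate :: "'s set \<Rightarrow> ('s \<Rightarrow> 's \<Rightarrow> real) \<Rightarrow> 's \<Rightarrow> 's \<Rightarrow> 's \<Rightarrow> real" where
  "eliminate X r z x y = r x y + r x z * r z y / (\<Sum>y\<in>X - {z}. r z y)"

context rooted_chain
begin

lemma exit_rate_pos:
  assumes "z \<in> X - {e}"
  shows "0 < (\<Sum>y\<in>X - {z}. r z y)"
proof -
  obtain y where "y \<in> X - {z}" "0 < r z y"
    using escape[of "{z}"] assms by auto
  then show ?thesis
    using finite_states rate_nonneg assms by (intro sum_pos2[of _ y]) auto
qed

lemma rooted_chain_eliminate:
  assumes z: "z \<in> X - {e}"
  shows "rooted_chain (X - {z}) (eliminate X r z) e"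
proof
  have out: "0 < (\<Sum>y\<in>X - {z}. r z y)"
    using exit_rate_pos[OF z] .
  show "finite (X - {z})" "e \<in> X - {z}"
    using finite_states root z by auto
  show "0 \<le> eliminate X r z x y" if "x \<in> X - {z}" "y \<in> X - {z}" for x y
    unfolding eliminate_def using that z out rate_nonneg
    by (intro add_nonneg_nonneg divide_nonneg_pos mult_nonneg_nonneg) auto
  show "\<exists>x\<in>A. \<exists>y\<in>X - {z} - A. 0 < eliminate X r z x y"
    if A: "A \<subseteq> X - {z} - {e}" "A \<noteq> {}" for A
  proof -
    have AX: "x \<in> X" if "x \<in> A" for x using A that by auto
    obtain x y where xy: "x \<in> A" "y \<in> X - A" "0 < r x y"
      using escape[of A] A by auto
    show ?thesis
    proof (cases "y = z")
      case False
      have "0 \<le> r x z * r z y / (\<Sum>y\<in>X - {z}. r z y)"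
        using xy AX z out rate_nonneg
        by (intro divide_nonneg_pos mult_nonneg_nonneg) auto
      then have "0 < eliminate X r z x y"
        using xy by (simp add: eliminate_def)
      then show ?thesis using xy False by blast
    next
      case True
      \<comment> \<open>When the escape from \<open>A\<close> found first leads to \<open>z\<close>,
        \<open>z\<close> is added to the set. The new escape starts in \<open>A\<close>, or it
        starts in \<open>z\<close> and then the detour through \<open>z\<close> has positive
        rate.\<close>
      obtain x' y' where xy': "x' \<in> insert z A" "y' \<in> X - insert z A" "0 < r x' y'"
        using escape[of "insert z A"] A z by auto
      have nonneg: "0 \<le> r b z * r z y' / (\<Sum>y\<in>X - {z}. r z y)" if "b \<in> A" for b
        using xy' AX z out rate_nonneg that
        by (intro divide_nonneg_pos mult_nonneg_nonneg) auto
      show ?thesis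
      proof (cases "x' = z")
        case False
        then have "0 < eliminate X r z x' y'"
          using xy' nonneg[of x'] by (simp add: eliminate_def)
        then show ?thesis using xy' False by blast
      next
        case x': True
        have "0 < r x z * r z y' / (\<Sum>y\<in>X - {z}. r z y)"
          using xy xy' x' True out by simp
        then have "0 < eliminate X r z x y'"
          using xy xy' AX rate_nonneg[of x y'] by (simp add: eliminate_def)
        then show ?thesis using xy xy' by blast
      qed
    qed
  qed
qed

end

section \<open>Balance and Poisson equations by elimination of states\<close>

text \<open>Gaussian elimination on the state space: a balanced vector of the chain watched outside
  \<open>z\<close> extends to \<open>z\<close>, and the detours in \<open>eliminate\<close> account
  for the flow through \<open>z\<close>. The root is never eliminated, so the normalisation at
  \<open>e\<close> is kept throughout.\<close>

lemma rooted_chain_balanced_exists: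
  fixes r :: "'s \<Rightarrow> 's \<Rightarrow> real"
  assumes "rooted_chain X r e"
  shows "\<exists>v. v e = 1 \<and> (\<forall>x\<in>X. 0 \<le> v x) \<and>
    (\<forall>y\<in>X. (\<Sum>x\<in>X. v x * r x y) = v y * (\<Sum>z\<in>X. r y z))"
  using assms
proof (induction "card X" arbitrary: X r)
  case 0
  then interpret rooted_chain X r e by simp
  show ?case using 0 finite_states root by auto
next
  case (Suc k)
  then interpret rooted_chain X r e by simp
  show ?case
  proof (cases "X = {e}")
    case True
    then show ?thesis by (intro exI[of _ "\<lambda>_. 1"]) auto
  next
    case False
    then obtain z where z: "z \<in> X - {e}" using root by blast
    define Y where "Y = X - {z}"
    define out where "out = (\<Sum>y\<in>Y. r z y)"
    have out: "0 < out" using exit_rate_pos[OF z] by (simp add: out_def Y_def)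
    have XY: "X = insert z Y" "z \<notin> Y" "finite Y"
      using z finite_states by (auto simp: Y_def)
    have "k = card Y" using Suc(2) XY by simp
    with Suc(1)[OF this rooted_chain_eliminate[OF z, folded Y_def]]
    obtain v where v: "v e = 1" "\<And>x. x \<in> Y \<Longrightarrow> 0 \<le> v x"
      and bal: "\<And>y. y \<in> Y \<Longrightarrow> (\<Sum>x\<in>Y. v x * eliminate X r z x y) = v y * (\<Sum>x\<in>Y. eliminate X r z y x)"
      by blast
    \<comment> \<open>Balance at \<open>z\<close> forces this value: inflow divided by exit
      rate.\<close>
    define w where "w = v(z := (\<Sum>x\<in>Y. v x * r x z) / out)"
    have wY: "w x = v x" if "x \<in> Y" for x
      using that XY by (auto simp: w_def)
    have wz: "w z * out = (\<Sum>x\<in>Y. v x * r x z)" using out by (simp add: w_def)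
    have elim: "eliminate X r z x y = r x y + r x z * r z y / out" for x y
      by (simp add: eliminate_def out_def Y_def)
    show ?thesis
    proof (intro exI[of _ w] conjI ballI)
      show "w e = 1" using v z by (auto simp: w_def)
      show "0 \<le> w x" if "x \<in> X" for x
        using that v(2) out z rate_nonneg XY
        by (auto simp: w_def intro!: divide_nonneg_pos sum_nonneg mult_nonneg_nonneg)
      fix y assume y: "y \<in> X"
      have ws: "(\<Sum>x\<in>Y. w x * r x b) = (\<Sum>x\<in>Y. v x * r x b)" for b
        by (intro sum.cong) (auto simp: wY)
      show "(\<Sum>x\<in>X. w x * r x y) = w y * (\<Sum>z\<in>X. r y z)"
      proof (cases "y = z")
        case True
        then show ?thesis
          using XY wz by (simp add: ws algebra_simps out_def)
      next
        case False
        then have yY: "y \<in> Y" using y XY by simp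
        have l: "(\<Sum>x\<in>Y. v x * eliminate X r z x y)
            = (\<Sum>x\<in>Y. v x * r x y) + (\<Sum>x\<in>Y. v x * r x z) * r z y / out"
          by (simp add: elim algebra_simps sum.distrib sum_distrib_left sum_distrib_right sum_divide_distrib)
        have rr: "(\<Sum>x\<in>Y. eliminate X r z y x) = (\<Sum>x\<in>Y. r y x) + r y z * (\<Sum>x\<in>Y. r z x) / out"
          by (simp add: elim sum.distrib sum_distrib_left sum_divide_distrib)
        have "(\<Sum>x\<in>X. w x * r x y) = w z * r z y + (\<Sum>x\<in>Y. v x * r x y)"
          using XY by (simp add: ws)
        also have "w z = (\<Sum>x\<in>Y. v x * r x z) / out" using wz out by (simp add: field_simps)
        finally have "(\<Sum>x\<in>X. w x * r x y) = (\<Sum>x\<in>Y. v x * eliminate X r z x y)"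
          by (simp add: l)
        also have "\<dots> = v y * ((\<Sum>x\<in>Y. r y x) + r y z)"
          using bal[OF yY] out by (simp add: rr out_def[symmetric])
        also have "\<dots> = w y * (\<Sum>z\<in>X. r y z)"
          using XY yY by (simp add: wY algebra_simps)
        finally show ?thesis .
      qed
    qed
  qed
qed

text \<open>\<open>u x\<close> is the expected cost, accumulated at rate \<open>c\<close>, before
  the root is reached. The elimination used for the balance equations applies once the cost spent in
  \<open>z\<close> has been passed on to its predecessors.\<close>

lemma rooted_chain_poisson_exists:
  fixes r :: "'s \<Rightarrow> 's \<Rightarrow> real"
  assumes "rooted_chain X r e" "\<And>x. x \<in> X \<Longrightarrow> 0 \<le> c x"
  shows "\<exists>u. u e = 0 \<and> (\<forall>x\<in>X. 0 \<le> u x) \<and> (\<forall>x\<in>X - {e}. generator X r u x = - c x)"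
  using assms
proof (induction "card X" arbitrary: X r c)
  case 0
  then interpret rooted_chain X r e by simp
  show ?case using 0 finite_states root by auto
next
  case (Suc k)
  then interpret rooted_chain X r e by simp
  show ?case
  proof (cases "X = {e}")
    case True
    then show ?thesis by (intro exI[of _ "\<lambda>_. 0"]) auto
  next
    case False
    then obtain z where z: "z \<in> X - {e}" using root by blast
    define Y where "Y = X - {z}"
    define out where "out = (\<Sum>y\<in>Y. r z y)"
    have out: "0 < out" using exit_rate_pos[OF z] by (simp add: out_def Y_def)
    have XY: "X = insert z Y" "z \<notin> Y" "finite Y"
      using z finite_states by (auto simp: Y_def)
    have kY: "k = card Y" using Suc(2) XY by simp
    \<comment> \<open>A stay in \<open>z\<close> costs \<open>c z / out\<close> on average; each
      \<open>x\<close> pays it at the rate of its jumps to \<open>z\<close>.\<close>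
    define d where "d x = c x + r x z * c z / out" for x
    have d: "0 \<le> d x" if "x \<in> Y" for x
      unfolding d_def using that Suc.prems(2) rate_nonneg out XY z
      by (intro add_nonneg_nonneg divide_nonneg_pos mult_nonneg_nonneg) auto
    obtain v where v: "v e = 0" "\<And>x. x \<in> Y \<Longrightarrow> 0 \<le> v x"
      and gen: "\<And>x. x \<in> Y - {e} \<Longrightarrow> generator Y (eliminate X r z) v x = - d x"
      using Suc(1)[where c = d, OF kY rooted_chain_eliminate[OF z, folded Y_def]] d by blast
    \<comment> \<open>The first-step equation at \<open>z\<close>, solved for the value at
      \<open>z\<close>.\<close>
    define w where "w = v(z := (c z + (\<Sum>y\<in>Y. r z y * v y)) / out)"
    have wY: "w x = v x" if "x \<in> Y" for x
      using that XY by (auto simp: w_def)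
    have wz: "w z * out = c z + (\<Sum>y\<in>Y. r z y * v y)" using out by (simp add: w_def)
    have elim: "eliminate X r z x y = r x y + r x z * r z y / out" for x y
      by (simp add: eliminate_def out_def Y_def)
    have ws: "(\<Sum>y\<in>Y. r x y * (w y - b)) = (\<Sum>y\<in>Y. r x y * (v y - b))" for x b
      by (intro sum.cong) (auto simp: wY)
    show ?thesis
    proof (intro exI[of _ w] conjI ballI)
      show "w e = 0" using v z by (auto simp: w_def)
      show "0 \<le> w x" if "x \<in> X" for x
        using that v(2) out z rate_nonneg XY Suc.prems(2)
        by (auto simp: w_def intro!: divide_nonneg_pos sum_nonneg add_nonneg_nonneg)
      fix x assume x: "x \<in> X - {e}"
      have zz: "(\<Sum>y\<in>Y. r z y * (v y - b)) = (w z - b) * out - c z" for b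
      proof -
        have "(\<Sum>y\<in>Y. r z y * (v y - b)) = (\<Sum>y\<in>Y. r z y * v y) - b * out"
          unfolding right_diff_distrib sum_subtractf out_def sum_distrib_left
          by (simp add: mult.commute)
        then show ?thesis using wz by (simp add: algebra_simps)
      qed
      show "generator X r w x = - c x"
      proof (cases "x = z")
        case True
        then show ?thesis
          using XY zz[of "w z"] by (simp add: generator_def ws)
      next
        case False
        then have xY: "x \<in> Y - {e}" using x XY by simp
        have "generator Y (eliminate X r z) v x
            = (\<Sum>y\<in>Y. r x y * (v y - v x)) + r x z / out * (\<Sum>y\<in>Y. r z y * (v y - v x))"
          unfolding generator_def elim sum_distrib_left sum.distrib[symmetric]
          using out by (intro sum.cong) (auto simp: field_simps)
        also have "\<dots> = (\<Sum>y\<in>Y. r x y * (v y - v x)) + r x z * (w z - v x) - r x z * c z / out"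
          using out unfolding zz by (simp add: field_simps)
        also have "(\<Sum>y\<in>Y. r x y * (v y - v x)) + r x z * (w z - v x) = generator X r w x"
          using XY xY by (simp add: generator_def ws wY)
        finally show ?thesis using gen[OF xY] by (simp add: d_def)
      qed
    qed
  qed
qed

section \<open>Stationary distributions: test functions, existence, uniqueness\<close>

lemma sum_diff_singleton_balance:
  fixes v :: "'s \<Rightarrow> real"
  assumes "finite X" "y \<in> X"
  shows "(\<Sum>x\<in>X - {y}. v x * r x y) = v y * (\<Sum>z\<in>X - {y}. r y z) \<longleftrightarrow>
    (\<Sum>x\<in>X. v x * r x y) = v y * (\<Sum>z\<in>X. r y z)"
  using assms by (simp add: sum.remove[of X y] algebra_simps)

lemma stationary_distribution_sum:
  assumes "finite X" "stationary_distribution X r \<pi>"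
  shows "(\<Sum>x\<in>X. pmf \<pi> x) = 1"
  using assms by (intro sum_pmf_eq_1) (auto simp: stationary_distribution_def)

text \<open>The weak form of global balance: exchanging the two sums moves the rates onto
  \<open>u\<close>. The identities for \<open>idle\<close> below all arise from a choice of
  \<open>u\<close>.\<close>

lemma stationary_distribution_generator:
  fixes u :: "'s \<Rightarrow> real"
  assumes "finite X" "stationary_distribution X r \<pi>"
  shows "(\<Sum>x\<in>X. pmf \<pi> x * generator X r u x) = 0"
proof -
  have bal: "(\<Sum>x\<in>X. pmf \<pi> x * r x y) = pmf \<pi> y * (\<Sum>z\<in>X. r y z)" if "y \<in> X" for y
    using assms that sum_diff_singleton_balance[of X y "pmf \<pi>" r]
    by (auto simp: stationary_distribution_def)
  have "(\<Sum>x\<in>X. pmf \<pi> x * generator X r u x)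
      = (\<Sum>x\<in>X. \<Sum>y\<in>X. pmf \<pi> x * r x y * u y) - (\<Sum>x\<in>X. pmf \<pi> x * (\<Sum>y\<in>X. r x y) * u x)"
    unfolding generator_def sum_subtractf[symmetric]
    by (intro sum.cong) (simp_all add: sum_distrib_left sum_distrib_right sum_subtractf[symmetric] algebra_simps)
  also have "(\<Sum>x\<in>X. \<Sum>y\<in>X. pmf \<pi> x * r x y * u y) = (\<Sum>y\<in>X. (\<Sum>x\<in>X. pmf \<pi> x * r x y) * u y)"
    by (subst sum.swap) (simp add: sum_distrib_right)
  also have "\<dots> = (\<Sum>y\<in>X. pmf \<pi> y * (\<Sum>z\<in>X. r y z) * u y)"
    by (intro sum.cong) (auto simp: bal)
  finally show ?thesis by simp
qed

lemma stationary_distribution_support: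
  assumes "finite X" "stationary_distribution X r \<pi>"
    and nonneg: "\<And>x y. x \<in> X \<Longrightarrow> y \<in> X \<Longrightarrow> 0 \<le> r x y"
    and "0 < pmf \<pi> x" "x \<in> X" "y \<in> X" "0 < r x y"
  shows "0 < pmf \<pi> y"
proof (rule ccontr)
  assume "\<not> 0 < pmf \<pi> y"
  then have y: "pmf \<pi> y = 0" using pmf_nonneg[of \<pi> y] by linarith
  with assms have "x \<noteq> y" by auto
  have "(\<Sum>x\<in>X - {y}. pmf \<pi> x * r x y) = 0"
    using assms y by (simp add: stationary_distribution_def)
  moreover have "0 < (\<Sum>x\<in>X - {y}. pmf \<pi> x * r x y)"
    using assms \<open>x \<noteq> y\<close> by (intro sum_pos2[of _ x] mult_pos_pos mult_nonneg_nonneg) auto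
  ultimately show False by simp
qed

context rooted_chain
begin

lemma stationary_distribution_exists: "\<exists>\<pi>. stationary_distribution X r \<pi>"
proof -
  obtain v where v: "v e = 1" "\<And>x. x \<in> X \<Longrightarrow> 0 \<le> v x"
    and bal: "\<And>y. y \<in> X \<Longrightarrow> (\<Sum>x\<in>X. v x * r x y) = v y * (\<Sum>z\<in>X. r y z)"
    using rooted_chain_balanced_exists[OF rooted_chain_axioms] by blast
  define Z where "Z = (\<Sum>x\<in>X. v x)"
  have Z: "0 < Z"
    unfolding Z_def using v root finite_states by (intro sum_pos2[of _ e]) auto
  define w where "w x = (if x \<in> X then v x / Z else 0)" for x
  have w: "0 \<le> w x" for x using v Z by (auto simp: w_def)
  have "(\<integral>\<^sup>+x. ennreal (w x) \<partial>count_space UNIV) = (\<integral>\<^sup>+x\<in>X. ennreal (w x) \<partial>count_space UNIV)"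
    by (intro nn_integral_cong) (auto simp: w_def indicator_def)
  also have "\<dots> = (\<integral>\<^sup>+x. ennreal (w x) \<partial>count_space X)"
    by (simp add: nn_integral_count_space_indicator)
  also have "\<dots> = ennreal (\<Sum>x\<in>X. w x)"
    using w finite_states by (simp add: nn_integral_count_space_finite sum_ennreal)
  also have "(\<Sum>x\<in>X. w x) = 1"
    using Z by (simp add: w_def sum_divide_distrib[symmetric] Z_def[symmetric])
  finally have pmf: "pmf (embed_pmf w) x = w x" for x
    using w by (intro pmf_embed_pmf) auto
  have "stationary_distribution X r (embed_pmf w)"
    unfolding stationary_distribution_def
  proof (intro conjI ballI)
    show "set_pmf (embed_pmf w) \<subseteq> X"
      by (auto simp: set_pmf_eq pmf w_def)
    fix y assume y: "y \<in> X"
    have "(\<Sum>x\<in>X. w x * r x y) = (\<Sum>x\<in>X. v x * r x y) / Z"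
      by (simp add: w_def sum_divide_distrib)
    also have "\<dots> = w y * (\<Sum>z\<in>X. r y z)" using bal[OF y] y by (simp add: w_def)
    finally show "(\<Sum>x\<in>X - {y}. pmf (embed_pmf w) x * r x y)
        = pmf (embed_pmf w) y * (\<Sum>z\<in>X - {y}. r y z)"
      using sum_diff_singleton_balance[OF finite_states y, of w r] by (simp add: pmf)
  qed
  then show ?thesis by blast
qed

text \<open>A cycle formula: it expresses a stationary cost outside the root by the mass of the root
  and data of the chain. Indicators as \<open>c\<close> give the masses of single states.\<close>

lemma stationary_distribution_root:
  fixes u :: "'s \<Rightarrow> real"
  assumes "stationary_distribution X r \<pi>"
    and "\<And>x. x \<in> X - {e} \<Longrightarrow> generator X r u x = - c x"
  shows "(\<Sum>x\<in>X - {e}. pmf \<pi> x * c x) = pmf \<pi> e * generator X r u e"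
proof -
  have "(\<Sum>x\<in>X - {e}. pmf \<pi> x * c x) = - (\<Sum>x\<in>X - {e}. pmf \<pi> x * generator X r u x)"
    using assms(2) by (simp add: sum_negf[symmetric])
  then show ?thesis
    using stationary_distribution_generator[OF finite_states assms(1), of u] root finite_states
    by (simp add: sum.remove[of X e])
qed

text \<open>Taking for \<open>c\<close> the indicator of a state shows that its mass is a multiple
  of the mass of the root, with a factor that does not depend on the distribution. The total mass
  one then fixes the mass of the root.\<close>

lemma stationary_distribution_unique:
  assumes st: "stationary_distribution X r \<pi>" "stationary_distribution X r \<pi>'"
  shows "\<pi> = \<pi>'"
proof -
  have "\<exists>K. \<forall>\<pi>. stationary_distribution X r \<pi> \<longrightarrow> pmf \<pi> x = pmf \<pi> e * K" if x: "x \<in> X - {e}" for x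
  proof -
    obtain u where u: "\<And>y. y \<in> X - {e} \<Longrightarrow> generator X r u y = - (if y = x then 1 else 0)"
      using rooted_chain_poisson_exists[OF rooted_chain_axioms, of "\<lambda>y. if y = x then 1 else 0"] by force
    have "pmf \<rho> x = pmf \<rho> e * generator X r u e" if "stationary_distribution X r \<rho>" for \<rho>
      using stationary_distribution_root[OF that u] x finite_states
      by (simp add: if_distrib cong: if_cong)
    then show ?thesis by blast
  qed
  then obtain K where K: "\<And>x \<rho>. x \<in> X - {e} \<Longrightarrow> stationary_distribution X r \<rho> \<Longrightarrow> pmf \<rho> x = pmf \<rho> e * K x"
    by metis
  have e: "pmf \<rho> e * (1 + (\<Sum>x\<in>X - {e}. K x)) = 1" if "stationary_distribution X r \<rho>" for \<rho>
    using stationary_distribution_sum[OF finite_states that] root finite_states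
    by (simp add: sum.remove[of X e] K[OF _ that] algebra_simps sum_distrib_left)
  from e[OF st(1)] e[OF st(2)] have "pmf \<pi> e = pmf \<pi>' e"
    by (metis mult_cancel_right mult_zero_right zero_neq_one)
  then have X: "pmf \<pi> x = pmf \<pi>' x" if "x \<in> X" for x
    using K[of x \<pi>] K[of x \<pi>'] st that by (cases "x = e") auto
  show ?thesis
  proof (rule pmf_eqI)
    fix x
    show "pmf \<pi> x = pmf \<pi>' x"
    proof (cases "x \<in> X")
      case False
      then have "x \<notin> set_pmf \<pi>" "x \<notin> set_pmf \<pi>'"
        using st by (auto simp: stationary_distribution_def)
      then show ?thesis by (simp add: set_pmf_iff)
    qed (rule X)
  qed
qed

end

section \<open>Generator of the pooling chain\<close>

lemma sum_rp_states:
  fixes f :: "rp_state \<Rightarrow> real"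
  shows "(\<Sum>x\<in>rp_states n m. f x) = f Empty + (\<Sum>q=1..m + 1. \<Sum>j<n. f (Busy q j))"
proof -
  have X: "rp_states n m = insert Empty ((\<lambda>(q, j). Busy q j) ` ({1..m + 1} \<times> {..<n}))"
    by (auto simp: rp_states_def)
  have "(\<Sum>x\<in>(\<lambda>(q, j). Busy q j) ` ({1..m + 1} \<times> {..<n}). f x)
      = (\<Sum>(q, j)\<in>{1..m + 1} \<times> {..<n}. f (Busy q j))"
    by (subst sum.reindex) (auto simp: inj_on_def case_prod_beta)
  then show ?thesis
    unfolding X by (subst sum.insert) (auto simp: sum.cartesian_product)
qed

lemma finite_rp_states: "finite (rp_states n m)"
proof -
  have "rp_states n m = insert Empty ((\<lambda>(q, j). Busy q j) ` ({1..m + 1} \<times> {..<n}))"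
    by (auto simp: rp_states_def)
  then show ?thesis by simp
qed

section \<open>Phase-type distributions and their means\<close>

lemma phase_type_carrier:
  "phase_type \<alpha> S \<Longrightarrow> S \<in> carrier_mat (dim_vec \<alpha>) (dim_vec \<alpha>)"
  by (auto simp: phase_type_def subgenerator_mat_def square_mat.simps)

lemma phase_type_mat_inverse:
  assumes "phase_type \<alpha> S"
  obtains M where "mat_inverse (- S) = Some M" "M \<in> carrier_mat (dim_vec \<alpha>) (dim_vec \<alpha>)"
    "- S * M = 1\<^sub>m (dim_vec \<alpha>)" "M * - S = 1\<^sub>m (dim_vec \<alpha>)"
proof -
  let ?n = "dim_vec \<alpha>"
  have S: "S \<in> carrier_mat ?n ?n" using phase_type_carrier[OF assms] .
  obtain B where B: "inverts_mat S B" "inverts_mat B S"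
    using assms by (auto simp: phase_type_def invertible_mat_def)
  have SB: "S * B = 1\<^sub>m ?n" "B * S = 1\<^sub>m (dim_row B)"
    using B S by (auto simp: inverts_mat_def)
  \<comment> \<open>\<open>inverts_mat\<close> does not state the dimensions of \<open>B\<close>;
    they are read off from the columns of the two products.\<close>
  have "dim_col (S * B) = ?n" "dim_col (B * S) = dim_row B"
    by (simp_all only: SB index_one_mat)
  then have Bc: "B \<in> carrier_mat ?n ?n" using S by auto
  have "- S \<in> Units (ring_mat TYPE(real) ?n ())"
    unfolding Units_def ring_mat_def using S Bc SB
    by (auto intro!: exI[of _ "- B"] bexI[of _ "- B"] simp: uminus_mult_left_mat uminus_mult_right_mat)
  then obtain M where "mat_inverse (- S) = Some M"
    using mat_inverse(1)[of "- S" ?n "()"] S by (cases "mat_inverse (- S)") auto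
  then show ?thesis
    using mat_inverse(2)[of "- S" ?n M] S that by auto
qed

text \<open>A solution \<open>h\<close> of \<open>S h = -1\<close> must be the inverse of
  \<open>- S\<close> applied to the ones vector, so the mean is computed without an explicit
  inverse. \<open>h j\<close> is the mean remaining size of a job in phase \<open>j\<close>.\<close>

lemma ph_mean_eq:
  assumes ph: "phase_type \<alpha> S"
    and h: "\<And>j. j < dim_vec \<alpha> \<Longrightarrow> (\<Sum>i<dim_vec \<alpha>. S $$ (j, i) * h i) = -1"
  shows "ph_mean \<alpha> S = (\<Sum>j<dim_vec \<alpha>. \<alpha> $ j * h j)"
proof -
  let ?n = "dim_vec \<alpha>"
  note S = phase_type_carrier[OF ph]
  obtain M where M: "mat_inverse (- S) = Some M" "M \<in> carrier_mat ?n ?n" "M * - S = 1\<^sub>m ?n"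
    using phase_type_mat_inverse[OF ph] .
  have "- S *\<^sub>v vec ?n h = ones_vec ?n"
    using S h by (intro eq_vecI) (auto simp: scalar_prod_def atLeast0LessThan sum_negf)
  then have "M *\<^sub>v ones_vec ?n = (M * - S) *\<^sub>v vec ?n h"
    using S M by (subst assoc_mult_mat_vec[of _ ?n ?n _ ?n]) auto
  then have "M *\<^sub>v ones_vec ?n = vec ?n h" using M by simp
  then show ?thesis
    using M S by (simp add: ph_mean_def scalar_prod_def atLeast0LessThan)
qed

locale pooling_queue =
  fixes lam p :: real and \<alpha> :: "real vec" and S :: "real mat"
  assumes lam_pos: "0 < lam" and p_less_1: "p < 1" and mean_one: "mean_one_phase_type \<alpha> S"
begin

lemma phase_type: "phase_type \<alpha> S"
  using mean_one by (simp add: mean_one_phase_type_def)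

lemma dim_S: "S \<in> carrier_mat (dim_vec \<alpha>) (dim_vec \<alpha>)"
  by (rule phase_type_carrier[OF phase_type])

lemma alpha_nonneg: "j < dim_vec \<alpha> \<Longrightarrow> 0 \<le> \<alpha> $ j"
  and alpha_sum: "(\<Sum>j<dim_vec \<alpha>. \<alpha> $ j) = 1"
  using phase_type by (auto simp: phase_type_def probability_vec_def)

lemma alpha_pos_exists: "\<exists>j<dim_vec \<alpha>. 0 < \<alpha> $ j"
proof (rule ccontr)
  assume "\<not> ?thesis"
  then have "(\<Sum>j<dim_vec \<alpha>. \<alpha> $ j) \<le> 0"
    by (intro sum_nonpos) (metis lessThan_iff not_less)
  then show False by (simp add: alpha_sum)
qed

lemma S_nonneg: "i < dim_vec \<alpha> \<Longrightarrow> j < dim_vec \<alpha> \<Longrightarrow> i \<noteq> j \<Longrightarrow> 0 \<le> S $$ (i, j)"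
  using phase_type dim_S by (auto simp: phase_type_def subgenerator_mat_def)

lemma exit_vec_eq: "j < dim_vec \<alpha> \<Longrightarrow> exit_vec S $ j = - (\<Sum>i<dim_vec \<alpha>. S $$ (j, i))"
  using dim_S by (auto simp: exit_vec_def scalar_prod_def atLeast0LessThan)

lemma exit_vec_nonneg: "j < dim_vec \<alpha> \<Longrightarrow> 0 \<le> exit_vec S $ j"
  using phase_type dim_S by (auto simp: exit_vec_eq phase_type_def subgenerator_mat_def)

text \<open>Splits \<open>S\<close> into jumps between phases, with nonnegative weights on
  differences of \<open>f\<close>, and killing at the exit rate. Minimum arguments need this
  form.\<close>

lemma S_mult_diff:
  assumes "j < dim_vec \<alpha>"
  shows "(\<Sum>i<dim_vec \<alpha>. S $$ (j, i) * f i)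
    = (\<Sum>i\<in>{..<dim_vec \<alpha>} - {j}. S $$ (j, i) * (f i - f j)) - exit_vec S $ j * f j"
proof -
  have "(\<Sum>i\<in>{..<dim_vec \<alpha>} - {j}. S $$ (j, i) * (f i - f j)) = (\<Sum>i<dim_vec \<alpha>. S $$ (j, i) * (f i - f j))"
    using assms by (simp add: sum.remove[of _ j])
  also have "\<dots> = (\<Sum>i<dim_vec \<alpha>. S $$ (j, i) * f i) - (\<Sum>i<dim_vec \<alpha>. S $$ (j, i)) * f j"
    by (simp add: right_diff_distrib sum_subtractf sum_distrib_right)
  finally show ?thesis using assms by (simp add: exit_vec_eq)
qed

lemma phase_mean_exists:
  "\<exists>h. (\<forall>j<dim_vec \<alpha>. (\<Sum>i<dim_vec \<alpha>. S $$ (j, i) * h i) = -1) \<and>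
    (\<Sum>j<dim_vec \<alpha>. \<alpha> $ j * h j) = 1"
proof -
  let ?n = "dim_vec \<alpha>"
  obtain M where M: "mat_inverse (- S) = Some M" "M \<in> carrier_mat ?n ?n" "- S * M = 1\<^sub>m ?n"
    using phase_type_mat_inverse[OF phase_type] .
  define h where "h = M *\<^sub>v ones_vec ?n"
  have hdim: "dim_vec h = ?n" using M by (simp add: h_def)
  have "- S *\<^sub>v h = (- S * M) *\<^sub>v ones_vec ?n"
    unfolding h_def using dim_S M by (subst assoc_mult_mat_vec[of _ ?n ?n _ ?n]) auto
  then have Sh: "- S *\<^sub>v h = ones_vec ?n" using M by simp
  have "(\<Sum>i<?n. S $$ (j, i) * h $ i) = -1" if j: "j < ?n" for j
  proof -
    have "(- S *\<^sub>v h) $ j = 1" using j by (simp add: Sh)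
    then show ?thesis
      using j dim_S hdim by (simp add: scalar_prod_def atLeast0LessThan sum_negf)
  qed
  moreover from this have "(\<Sum>j<?n. \<alpha> $ j * h $ j) = 1"
    using ph_mean_eq[OF phase_type, of "($) h"] mean_one by (simp add: mean_one_phase_type_def)
  ultimately show ?thesis by blast
qed

text \<open>The generator at a busy state. Level 0 is given phases too, on which test functions are
  constant; a move to the empty state then has the same form as any other completion or pooling
  move. The diagonal of \<open>S\<close> contains the loss terms of phase changes and
  completions.\<close>

definition drift :: "nat \<Rightarrow> real \<Rightarrow> (nat \<Rightarrow> nat \<Rightarrow> real) \<Rightarrow> nat \<Rightarrow> nat \<Rightarrow> real" where
  "drift m \<omega> U q j =
     (if q \<le> m then lam * (U (q + 1) j - U q j) else \<omega> * (U (q - 1) j - U q j)) +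
     (1 - p) * ((\<Sum>i<dim_vec \<alpha>. S $$ (j, i) * U q i) +
       exit_vec S $ j * (\<Sum>i<dim_vec \<alpha>. \<alpha> $ i * U (q - 1) i))"

fun state_fun :: "(nat \<Rightarrow> nat \<Rightarrow> real) \<Rightarrow> rp_state \<Rightarrow> real" where
  "state_fun U Empty = U 0 0"
| "state_fun U (Busy q j) = U q j"

abbreviation states where "states m \<equiv> rp_states (dim_vec \<alpha>) m"
abbreviation rate where "rate m \<omega> \<equiv> rp_rate lam p \<alpha> S m \<omega>"

lemma generator_Empty:
  "generator (states m) (rate m \<omega>) (state_fun U) Empty =
    lam * ((\<Sum>j<dim_vec \<alpha>. \<alpha> $ j * U 1 j) - U 0 0)"
proof -
  have "generator (states m) (rate m \<omega>) (state_fun U) Empty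
     = (\<Sum>q=1..m + 1. \<Sum>j<dim_vec \<alpha>. (if q = 1 then lam * \<alpha> $ j else 0) * (U q j - U 0 0))"
    by (simp add: generator_def sum_rp_states)
  also have "\<dots> = (\<Sum>q=1..m + 1. if q = 1 then \<Sum>j<dim_vec \<alpha>. lam * \<alpha> $ j * (U 1 j - U 0 0) else 0)"
    by (intro sum.cong) auto
  also have "\<dots> = (\<Sum>j<dim_vec \<alpha>. lam * \<alpha> $ j * (U 1 j - U 0 0))" by simp
  also have "\<dots> = lam * ((\<Sum>j<dim_vec \<alpha>. \<alpha> $ j * U 1 j) - (\<Sum>j<dim_vec \<alpha>. \<alpha> $ j) * U 0 0)"
    by (simp add: right_diff_distrib sum_subtractf sum_distrib_left sum_distrib_right algebra_simps)
  finally show ?thesis by (simp add: alpha_sum)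
qed

lemma generator_Busy:
  assumes q: "1 \<le> q" "q \<le> m + 1" and j: "j < dim_vec \<alpha>"
    and U0: "\<And>i. i < dim_vec \<alpha> \<Longrightarrow> U 0 i = U 0 0"
  shows "generator (states m) (rate m \<omega>) (state_fun U) (Busy q j) = drift m \<omega> U q j"
proof -
  let ?n = "dim_vec \<alpha>" and ?s = "exit_vec S $ j"
  let ?D = "\<lambda>q' j'. U q' j' - U q j"
  \<comment> \<open>One sum per kind of transition: arrival, phase change, completion,
    pooling.\<close>
  have split: "(\<Sum>q'=1..m + 1. \<Sum>j'<?n. rate m \<omega> (Busy q j) (Busy q' j') * ?D q' j') =
    (\<Sum>q'=1..m + 1. \<Sum>j'<?n. (if q \<le> m \<and> q' = q + 1 \<and> j' = j then lam else 0) * ?D q' j') +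
    (\<Sum>q'=1..m + 1. \<Sum>j'<?n. (if q' = q \<and> j' \<noteq> j then (1 - p) * S $$ (j, j') else 0) * ?D q' j') +
    (\<Sum>q'=1..m + 1. \<Sum>j'<?n. (if 2 \<le> q \<and> q' = q - 1 then (1 - p) * ?s * \<alpha> $ j' else 0) * ?D q' j') +
    (\<Sum>q'=1..m + 1. \<Sum>j'<?n. (if 1 \<le> m \<and> q = m + 1 \<and> q' = m \<and> j' = j then \<omega> else 0) * ?D q' j')"
    by (simp only: sum.distrib[symmetric] rp_rate.simps distrib_right)
  have "(\<Sum>q'=1..m + 1. \<Sum>j'<?n. (if q \<le> m \<and> q' = q + 1 \<and> j' = j then lam else 0) * ?D q' j')
    = (\<Sum>q'=1..m + 1. if q' = q + 1 then (if q \<le> m then lam * ?D (q + 1) j else 0) else 0)"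
    using j by (intro sum.cong) (auto simp: if_distrib[of "\<lambda>x. x * _"] cong: if_cong)
  also have "\<dots> = (if q \<le> m then lam * ?D (q + 1) j else 0)" by auto
  finally have up: "(\<Sum>q'=1..m + 1. \<Sum>j'<?n. (if q \<le> m \<and> q' = q + 1 \<and> j' = j then lam else 0) * ?D q' j') = \<dots>" .
  have "(\<Sum>q'=1..m + 1. \<Sum>j'<?n. (if q' = q \<and> j' \<noteq> j then (1 - p) * S $$ (j, j') else 0) * ?D q' j')
    = (\<Sum>q'=1..m + 1. if q' = q then (\<Sum>j'<?n. (1 - p) * (S $$ (j, j') * ?D q j')) else 0)"
    by (intro sum.cong refl) (auto intro!: sum.cong)
  also have "\<dots> = (1 - p) * (\<Sum>j'<?n. S $$ (j, j') * ?D q j')"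
    using q by (simp add: sum_distrib_left)
  also have "(\<Sum>j'<?n. S $$ (j, j') * ?D q j') = (\<Sum>i<?n. S $$ (j, i) * U q i) + ?s * U q j"
    using j by (simp add: exit_vec_eq right_diff_distrib sum_subtractf sum_distrib_right)
  finally have phase: "(\<Sum>q'=1..m + 1. \<Sum>j'<?n. (if q' = q \<and> j' \<noteq> j then (1 - p) * S $$ (j, j') else 0) * ?D q' j')
    = (1 - p) * ((\<Sum>i<?n. S $$ (j, i) * U q i) + ?s * U q j)" .
  have av: "(\<Sum>i<?n. \<alpha> $ i * ?D b i) = (\<Sum>i<?n. \<alpha> $ i * U b i) - U q j" for b
    using alpha_sum by (simp add: right_diff_distrib sum_subtractf flip: sum_distrib_right)
  have "(\<Sum>q'=1..m + 1. \<Sum>j'<?n. (if 2 \<le> q \<and> q' = q - 1 then (1 - p) * ?s * \<alpha> $ j' else 0) * ?D q' j')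
    = (\<Sum>q'=1..m + 1. if q' = q - 1 then (if 2 \<le> q then (1 - p) * ?s * (\<Sum>i<?n. \<alpha> $ i * ?D (q - 1) i) else 0) else 0)"
    by (intro sum.cong) (auto simp: sum_distrib_left mult.assoc)
  also have "\<dots> = (if 2 \<le> q then (1 - p) * ?s * ((\<Sum>i<?n. \<alpha> $ i * U (q - 1) i) - U q j) else 0)"
    using q unfolding av by auto
  finally have down: "(\<Sum>q'=1..m + 1. \<Sum>j'<?n. (if 2 \<le> q \<and> q' = q - 1 then (1 - p) * ?s * \<alpha> $ j' else 0) * ?D q' j') = \<dots>" .
  have "(\<Sum>q'=1..m + 1. \<Sum>j'<?n. (if 1 \<le> m \<and> q = m + 1 \<and> q' = m \<and> j' = j then \<omega> else 0) * ?D q' j')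
    = (\<Sum>q'=1..m + 1. if q' = m then (if 1 \<le> m \<and> q = m + 1 then \<omega> * ?D m j else 0) else 0)"
    using j by (intro sum.cong) (auto simp: if_distrib[of "\<lambda>x. x * _"] cong: if_cong)
  also have "\<dots> = (if 1 \<le> m \<and> q = m + 1 then \<omega> * ?D m j else 0)" by auto
  finally have pool: "(\<Sum>q'=1..m + 1. \<Sum>j'<?n. (if 1 \<le> m \<and> q = m + 1 \<and> q' = m \<and> j' = j then \<omega> else 0) * ?D q' j') = \<dots>" .
  define c where "c = U 0 0"
  have U0av: "(\<Sum>i<?n. \<alpha> $ i * U 0 i) = U 0 0"
  proof -
    have "(\<Sum>i<?n. \<alpha> $ i * U 0 i) = (\<Sum>i<?n. \<alpha> $ i * c)"
      unfolding c_def by (intro sum.cong refl arg_cong2[of _ _ _ _ "(*)"] U0) auto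
    then show ?thesis using alpha_sum by (simp add: c_def flip: sum_distrib_right)
  qed
  have "generator (states m) (rate m \<omega>) (state_fun U) (Busy q j) =
    rate m \<omega> (Busy q j) Empty * (U 0 0 - U q j) +
    (\<Sum>q'=1..m + 1. \<Sum>j'<?n. rate m \<omega> (Busy q j) (Busy q' j') * ?D q' j')"
    by (simp add: generator_def sum_rp_states)
  also have "\<dots> = drift m \<omega> U q j"
    unfolding split up phase down pool drift_def
  proof (cases "q = 1")
    \<comment> \<open>At \<open>q = 1\<close> completions, and pooling if \<open>m = 0\<close>, lead
      to \<open>Empty\<close>. Since \<open>U 0\<close> is constant, its value there is also the
      mean over the initial phase of a job.\<close>
    case True
    show "rate m \<omega> (Busy q j) Empty * (U 0 0 - U q j) +
      ((if q \<le> m then lam * ?D (q + 1) j else 0) +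
       (1 - p) * ((\<Sum>i<?n. S $$ (j, i) * U q i) + ?s * U q j) +
       (if 2 \<le> q then (1 - p) * ?s * ((\<Sum>i<?n. \<alpha> $ i * U (q - 1) i) - U q j) else 0) +
       (if 1 \<le> m \<and> q = m + 1 then \<omega> * ?D m j else 0)) =
      (if q \<le> m then lam * ?D (q + 1) j else \<omega> * ?D (q - 1) j) +
      (1 - p) * ((\<Sum>i<?n. S $$ (j, i) * U q i) + ?s * (\<Sum>i<?n. \<alpha> $ i * U (q - 1) i))"
      using True U0[OF j] by (cases "m = 0") (auto simp: U0av algebra_simps)
  next
    case False
    have cancel: "(1 - p) * (X + ?s * U q j) + (1 - p) * ?s * (Y - U q j) = (1 - p) * (X + ?s * Y)" for X Y
      by (simp add: algebra_simps)
    show "rate m \<omega> (Busy q j) Empty * (U 0 0 - U q j) +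
      ((if q \<le> m then lam * ?D (q + 1) j else 0) +
       (1 - p) * ((\<Sum>i<?n. S $$ (j, i) * U q i) + ?s * U q j) +
       (if 2 \<le> q then (1 - p) * ?s * ((\<Sum>i<?n. \<alpha> $ i * U (q - 1) i) - U q j) else 0) +
       (if 1 \<le> m \<and> q = m + 1 then \<omega> * ?D m j else 0)) =
      (if q \<le> m then lam * ?D (q + 1) j else \<omega> * ?D (q - 1) j) +
      (1 - p) * ((\<Sum>i<?n. S $$ (j, i) * U q i) + ?s * (\<Sum>i<?n. \<alpha> $ i * U (q - 1) i))"
    proof (cases "q \<le> m")
      case True
      then show ?thesis using False q cancel by simp
    next
      case qm: False
      then have "q = m + 1" "1 \<le> m" using q False by auto
      then show ?thesis
        using cancel[of "\<Sum>i<?n. S $$ (j, i) * U q i" "\<Sum>i<?n. \<alpha> $ i * U (q - 1) i"] by simp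
    qed
  qed
  finally show ?thesis .
qed

lemma stationary_drift:
  assumes "stationary_distribution (states m) (rate m \<omega>) \<pi>"
    and "\<And>i. i < dim_vec \<alpha> \<Longrightarrow> U 0 i = c"
  shows "pmf \<pi> Empty * (lam * ((\<Sum>j<dim_vec \<alpha>. \<alpha> $ j * U 1 j) - c)) +
    (\<Sum>q=1..m + 1. \<Sum>j<dim_vec \<alpha>. pmf \<pi> (Busy q j) * drift m \<omega> U q j) = 0"
proof -
  have c: "U 0 0 = c" using alpha_pos_exists assms(2)[of 0] by auto
  have "0 = (\<Sum>x\<in>states m. pmf \<pi> x * generator (states m) (rate m \<omega>) (state_fun U) x)"
    using stationary_distribution_generator[OF finite_rp_states assms(1)] by simp
  also have "\<dots> = pmf \<pi> Empty * (lam * ((\<Sum>j<dim_vec \<alpha>. \<alpha> $ j * U 1 j) - c)) +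
    (\<Sum>q=1..m + 1. \<Sum>j<dim_vec \<alpha>. pmf \<pi> (Busy q j) * generator (states m) (rate m \<omega>) (state_fun U) (Busy q j))"
    unfolding sum_rp_states generator_Empty c ..
  also have "(\<Sum>q=1..m + 1. \<Sum>j<dim_vec \<alpha>. pmf \<pi> (Busy q j) * generator (states m) (rate m \<omega>) (state_fun U) (Busy q j))
    = (\<Sum>q=1..m + 1. \<Sum>j<dim_vec \<alpha>. pmf \<pi> (Busy q j) * drift m \<omega> U q j)"
  proof (intro sum.cong refl)
    fix q j assume "q \<in> {1..m + 1}" "j \<in> {..<dim_vec \<alpha>}"
    then have "generator (states m) (rate m \<omega>) (state_fun U) (Busy q j) = drift m \<omega> U q j"
      by (intro generator_Busy) (auto simp: assms(2) c)
    then show "pmf \<pi> (Busy q j) * generator (states m) (rate m \<omega>) (state_fun U) (Busy q j)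
      = pmf \<pi> (Busy q j) * drift m \<omega> U q j" by simp
  qed
  finally show ?thesis by simp
qed

lemma stationary_sum:
  assumes "stationary_distribution (states m) (rate m \<omega>) \<pi>"
  shows "pmf \<pi> Empty + (\<Sum>q=1..m + 1. \<Sum>j<dim_vec \<alpha>. pmf \<pi> (Busy q j)) = 1"
  using stationary_distribution_sum[OF finite_rp_states assms] by (simp only: sum_rp_states)

section \<open>Accessibility of the empty state\<close>

text \<open>If all phases in \<open>B\<close> were unable to reach a completion, the expected remaining job size
  would decrease at unit rate forever, starting from its minimum over \<open>B\<close>.\<close>

lemma no_phase_trap:
  assumes "B \<subseteq> {..<dim_vec \<alpha>}" "B \<noteq> {}"
    and "\<And>j. j \<in> B \<Longrightarrow> exit_vec S $ j = 0"
    and "\<And>j i. j \<in> B \<Longrightarrow> i < dim_vec \<alpha> \<Longrightarrow> i \<notin> B \<Longrightarrow> S $$ (j, i) = 0"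
  shows False
proof -
  obtain h where h: "\<And>j. j < dim_vec \<alpha> \<Longrightarrow> (\<Sum>i<dim_vec \<alpha>. S $$ (j, i) * h i) = -1"
    using phase_mean_exists by blast
  have "finite B" using assms(1) finite_subset by blast
  then obtain j where j: "j \<in> B" "\<And>i. i \<in> B \<Longrightarrow> h j \<le> h i"
    using assms(2) arg_min_if_finite(1)[of B h] arg_min_least[of B _ h] by metis
  have "0 \<le> (\<Sum>i\<in>{..<dim_vec \<alpha>} - {j}. S $$ (j, i) * (h i - h j))"
  proof (rule sum_nonneg)
    fix i assume i: "i \<in> {..<dim_vec \<alpha>} - {j}"
    show "0 \<le> S $$ (j, i) * (h i - h j)"
      using i j assms(1) assms(4)[of j i] S_nonneg[of j i] by (cases "i \<in> B") auto
  qed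
  then show False
    using h[of j] S_mult_diff[of j h] j assms(1,3) by auto
qed

text \<open>A completion from the lowest level of \<open>A\<close> would lead below it or contradict
  \<open>bottom\<close>, so the phases of \<open>A\<close> at that level never complete and form a
  trap for \<open>no_phase_trap\<close>. This serves both reachability and the minimum principle for
  increments of emptying times.\<close>

lemma no_trap:
  fixes A :: "(nat \<times> nat) set"
  assumes "A \<noteq> {}" "A \<subseteq> {1..} \<times> {..<dim_vec \<alpha>}"
    and phase: "\<And>q j i. (q, j) \<in> A \<Longrightarrow> i < dim_vec \<alpha> \<Longrightarrow> i \<noteq> j \<Longrightarrow> 0 < S $$ (j, i) \<Longrightarrow> (q, i) \<in> A"
    and down: "\<And>q j i. (q, j) \<in> A \<Longrightarrow> i < dim_vec \<alpha> \<Longrightarrow> 2 \<le> q \<Longrightarrow> 0 < exit_vec S $ j \<Longrightarrow> 0 < \<alpha> $ i \<Longrightarrow> (q - 1, i) \<in> A"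
    and bottom: "\<And>j. (1, j) \<in> A \<Longrightarrow> exit_vec S $ j = 0"
  shows False
proof -
  define q where "q = (LEAST q. \<exists>j. (q, j) \<in> A)"
  have q: "\<exists>j. (q, j) \<in> A"
  proof -
    have "\<exists>q j. (q, j) \<in> A" using assms(1) by fast
    then show ?thesis unfolding q_def by (rule LeastI_ex[of "\<lambda>q. \<exists>j. (q, j) \<in> A"])
  qed
  have least: "q \<le> q'" if "(q', j) \<in> A" for q' j
    unfolding q_def using that by (intro Least_le[of "\<lambda>q. \<exists>j. (q, j) \<in> A"]) blast
  have q1: "1 \<le> q" using q assms(2) by auto
  obtain i where i: "i < dim_vec \<alpha>" "0 < \<alpha> $ i" using alpha_pos_exists by blast
  show False
  proof (rule no_phase_trap[of "{j. (q, j) \<in> A}"])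
    show "{j. (q, j) \<in> A} \<subseteq> {..<dim_vec \<alpha>}" "{j. (q, j) \<in> A} \<noteq> {}"
      using assms(2) q by auto
    show "S $$ (j, i) = 0" if "j \<in> {j. (q, j) \<in> A}" "i < dim_vec \<alpha>" "i \<notin> {j. (q, j) \<in> A}" for j i
    proof -
      have "j < dim_vec \<alpha>" "i \<noteq> j" using that assms(2) by auto
      then show ?thesis
        using that phase[of q j i] S_nonneg[of j i] by force
    qed
    show "exit_vec S $ j = 0" if "j \<in> {j. (q, j) \<in> A}" for j
    proof (rule ccontr)
      assume nz: "exit_vec S $ j \<noteq> 0"
      have "j < dim_vec \<alpha>" using that assms(2) by auto
      then have "0 < exit_vec S $ j" using exit_vec_nonneg[of j] nz by auto
      moreover have "2 \<le> q"
      proof (rule ccontr)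
        assume "\<not> 2 \<le> q"
        then have "q = 1" using q1 by simp
        then show False using bottom[of j] that nz by auto
      qed
      ultimately have "(q - 1, i) \<in> A" using down[of q j i] i that by auto
      then show False using least[of "q - 1" i] q1 by auto
    qed
  qed
qed

lemma rate_nonneg:
  assumes "0 \<le> \<omega>" "x \<in> states m" "y \<in> states m"
  shows "0 \<le> rate m \<omega> x y"
proof -
  have p: "0 \<le> 1 - p" using p_less_1 by simp
  show ?thesis
  proof (cases x)
    case Empty
    then show ?thesis using assms lam_pos alpha_nonneg by (cases y) (auto simp: rp_states_def)
  next
    case (Busy q j)
    then show ?thesis
      using assms p lam_pos alpha_nonneg S_nonneg exit_vec_nonneg
      by (cases y) (auto simp: rp_states_def intro!: add_nonneg_nonneg mult_nonneg_nonneg)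
  qed
qed

text \<open>A set of busy states that cannot be left would be closed under phase changes and
  completions, which \<open>no_trap\<close> excludes.\<close>

lemma rooted_chain:
  assumes \<omega>: "0 \<le> \<omega>"
  shows "rooted_chain (states m) (rate m \<omega>) Empty"
proof
  show "finite (states m)" by (rule finite_rp_states)
  show "Empty \<in> states m" by (simp add: rp_states_def)
  show "0 \<le> rate m \<omega> x y" if "x \<in> states m" "y \<in> states m" for x y
    using that \<omega> rate_nonneg by blast
  show "\<exists>x\<in>A. \<exists>y\<in>states m - A. 0 < rate m \<omega> x y" if A: "A \<subseteq> states m - {Empty}" "A \<noteq> {}" for A
  proof (rule ccontr)
    assume closed: "\<not> ?thesis"
    have closedD: "y \<in> A" if "x \<in> A" "y \<in> states m" "0 < rate m \<omega> x y" for x y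
      using closed that by blast
    have AD: "1 \<le> q \<and> q \<le> m + 1 \<and> j < dim_vec \<alpha>" if "Busy q j \<in> A" for q j
      using A that by (auto simp: rp_states_def)
    have p: "0 < 1 - p" using p_less_1 by simp
    show False
    proof (rule no_trap[of "{(q, j). Busy q j \<in> A}"])
      obtain x where "x \<in> A" using A by auto
      then show "{(q, j). Busy q j \<in> A} \<noteq> {}" using A by (cases x) auto
      show "{(q, j). Busy q j \<in> A} \<subseteq> {1..} \<times> {..<dim_vec \<alpha>}" using AD by auto
      show "(q, i) \<in> {(q, j). Busy q j \<in> A}"
        if "(q, j) \<in> {(q, j). Busy q j \<in> A}" "i < dim_vec \<alpha>" "i \<noteq> j" "0 < S $$ (j, i)" for q j i
      proof -
        have "0 < (1 - p) * S $$ (j, i)" using that p by simp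
        then have "0 < rate m \<omega> (Busy q j) (Busy q i)" using that by auto
        then show ?thesis
          using that closedD[of "Busy q j" "Busy q i"] AD[of q j] by (auto simp: rp_states_def)
      qed
      show "(q - 1, i) \<in> {(q, j). Busy q j \<in> A}"
        if *: "(q, j) \<in> {(q, j). Busy q j \<in> A}" "i < dim_vec \<alpha>" "2 \<le> q" "0 < exit_vec S $ j" "0 < \<alpha> $ i" for q j i
      proof -
        have "0 < (1 - p) * exit_vec S $ j * \<alpha> $ i" using * p by simp
        then have "0 < rate m \<omega> (Busy q j) (Busy (q - 1) i)" using * \<omega> by auto
        moreover have "Busy (q - 1) i \<in> states m"
          using * AD[of q j] by (auto simp: rp_states_def)
        ultimately show ?thesis
          using * closedD[of "Busy q j" "Busy (q - 1) i"] by blast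
      qed
      show "exit_vec S $ j = 0" if "(1, j) \<in> {(q, j). Busy q j \<in> A}" for j
      proof (rule ccontr)
        assume "exit_vec S $ j \<noteq> 0"
        then have "0 < (1 - p) * exit_vec S $ j"
          using that exit_vec_nonneg[of j] AD[of 1 j] p by auto
        then have "0 < rate m \<omega> (Busy 1 j) Empty" using \<omega> by auto
        then have "Empty \<in> A"
          using that closedD[of "Busy 1 j" Empty] by (auto simp: rp_states_def)
        then show False using A by auto
      qed
    qed
  qed
qed

lemma rp_stationary:
  assumes "0 \<le> \<omega>"
  shows "stationary_distribution (states m) (rate m \<omega>) (rp_stationary lam p \<alpha> S m \<omega>)"
proof -
  interpret rooted_chain "states m" "rate m \<omega>" Empty
    using rooted_chain[OF assms] .
  have "\<exists>!\<pi>. stationary_distribution (states m) (rate m \<omega>) \<pi>"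
    using stationary_distribution_exists stationary_distribution_unique by blast
  then show ?thesis unfolding rp_stationary_def by (rule theI')
qed

subsection \<open>Times to empty the queue\<close>

abbreviation prob where "prob m \<omega> \<equiv> pmf (rp_stationary lam p \<alpha> S m \<omega>)"
abbreviation idle where "idle m \<omega> \<equiv> prob m \<omega> Empty"

text \<open>Drift \<open>-1\<close> is the first-step equation of the expected time to reach
  \<open>Empty\<close>. Values above level \<open>m + 1\<close> are left free.\<close>

definition hitting_time :: "nat \<Rightarrow> real \<Rightarrow> (nat \<Rightarrow> nat \<Rightarrow> real) \<Rightarrow> bool" where
  "hitting_time m \<omega> U \<longleftrightarrow> (\<forall>j. U 0 j = 0) \<and>
     (\<forall>q\<in>{1..m + 1}. \<forall>j<dim_vec \<alpha>. 0 \<le> U q j \<and> drift m \<omega> U q j = -1)"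

lemma hitting_time_exists:
  assumes "0 \<le> \<omega>"
  obtains U where "hitting_time m \<omega> U"
proof -
  obtain u where u: "u Empty = 0" "\<And>x. x \<in> states m \<Longrightarrow> 0 \<le> u x"
    and gen: "\<And>x. x \<in> states m - {Empty} \<Longrightarrow> generator (states m) (rate m \<omega>) u x = - 1"
    using rooted_chain_poisson_exists[OF rooted_chain[OF assms, of m], where c = "\<lambda>_. 1"] by auto
  define U where "U q j = (if q = 0 then 0 else u (Busy q j))" for q j :: nat
  have eq: "state_fun U x = u x" if "x \<in> states m" for x
    using that u(1) by (auto simp: rp_states_def U_def)
  have in_states: "Busy q j \<in> states m" if "q \<in> {1..m + 1}" "j < dim_vec \<alpha>" for q j
    using that by (auto simp: rp_states_def)
  have "drift m \<omega> U q j = -1" if "q \<in> {1..m + 1}" "j < dim_vec \<alpha>" for q j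
  proof -
    have "drift m \<omega> U q j = generator (states m) (rate m \<omega>) (state_fun U) (Busy q j)"
      using that by (intro generator_Busy[symmetric]) (auto simp: U_def)
    also have "\<dots> = generator (states m) (rate m \<omega>) u (Busy q j)"
      unfolding generator_def eq[OF in_states[OF that]] by (intro sum.cong refl) (simp add: eq)
    also have "\<dots> = -1" using gen in_states[OF that] by simp
    finally show ?thesis .
  qed
  moreover have "0 \<le> U q j" if "q \<in> {1..m + 1}" "j < dim_vec \<alpha>" for q j
    using u(2)[OF in_states[OF that]] by (simp add: U_def)
  ultimately have "hitting_time m \<omega> U" by (auto simp: hitting_time_def U_def)
  then show ?thesis by (rule that)
qed

text \<open>The increments solve the equation of the same chain, killed at the top level. Hence the set
  where they attain a nonpositive minimum would be closed.\<close>

lemma hitting_time_increasing: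
  assumes \<omega>: "0 \<le> \<omega>" and U: "hitting_time m \<omega> U"
    and "1 \<le> q" "q \<le> m + 1" "j < dim_vec \<alpha>"
  shows "U (q - 1) j < U q j"
proof -
  let ?n = "dim_vec \<alpha>"
  define W where "W q j = U q j - U (q - 1) j" for q j :: nat
  have p: "0 < 1 - p" using p_less_1 by simp
  have U0: "U 0 j = 0" for j using U by (simp add: hitting_time_def)
  have U_nonneg: "0 \<le> U q j" if "q \<le> m + 1" "j < ?n" for q j
    using U that by (cases "q = 0") (auto simp: hitting_time_def)
  have drift: "drift m \<omega> U q j = -1" if "1 \<le> q" "q \<le> m + 1" "j < ?n" for q j
    using U that by (auto simp: hitting_time_def)
  \<comment> \<open>Level 1 is treated separately: a zero of the nonnegative \<open>U\<close> would
    have nonnegative drift.\<close>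
  have W1: "0 < W 1 j" if j: "j < ?n" for j
  proof (rule ccontr)
    assume "\<not> 0 < W 1 j"
    then have z: "U 1 j = 0" using U_nonneg[of 1 j] j by (simp add: W_def U0)
    have "0 \<le> (\<Sum>i\<in>{..<?n} - {j}. S $$ (j, i) * (U 1 i - U 1 j))"
      using j z S_nonneg[OF j] U_nonneg[of 1] by (intro sum_nonneg mult_nonneg_nonneg) auto
    then have "0 \<le> (1 - p) * ((\<Sum>i<?n. S $$ (j, i) * U 1 i) +
        exit_vec S $ j * (\<Sum>i<?n. \<alpha> $ i * U (1 - 1) i))"
      using p z by (simp add: S_mult_diff[OF j] U0)
    moreover have "0 \<le> (if 1 \<le> m then lam * (U (1 + 1) j - U 1 j) else \<omega> * (U (1 - 1) j - U 1 j))"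
      using z U0 U_nonneg[of "1 + 1" j] j lam_pos by simp
    ultimately have "0 \<le> drift m \<omega> U 1 j"
      unfolding drift_def by (rule add_nonneg_nonneg[rotated])
    then show False using drift[of 1 j] j by simp
  qed
  define D where "D = {1..m + 1} \<times> {..<?n}"
  have D: "finite D" "(q, j) \<in> D" using assms by (auto simp: D_def)
  define c where "c = Min ((\<lambda>(q, j). W q j) ` D)"
  have c_le: "c \<le> W q j" if "1 \<le> q" "q \<le> m + 1" "j < ?n" for q j
    unfolding c_def using D that by (intro Min_le) (auto simp: D_def intro!: image_eqI[of _ _ "(q, j)"])
  have "c \<in> (\<lambda>(q, j). W q j) ` D"
    unfolding c_def using D by (intro Min_in) auto
  then obtain q0 j0 where qj0: "(q0, j0) \<in> D" "W q0 j0 = c" by auto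
  have "0 < c"
  proof (rule ccontr)
    assume "\<not> 0 < c"
    then have c: "c \<le> 0" by simp
    define A where "A = {(q, j) \<in> D. W q j = c}"
    have AD: "2 \<le> q \<and> q \<le> m + 1 \<and> j < ?n \<and> W q j = c" if "(q, j) \<in> A" for q j
    proof -
      have "q \<noteq> 1" using W1[of j] c that by (auto simp: A_def D_def)
      then show ?thesis using that by (auto simp: A_def D_def)
    qed
    have key: "(\<Sum>i\<in>{..<?n} - {j}. S $$ (j, i) * (W q i - c)) = 0 \<and>
      exit_vec S $ j * (\<Sum>i<?n. \<alpha> $ i * (W (q - 1) i - c)) = 0"
      if "(q, j) \<in> A" for q j
    proof -
      have q: "2 \<le> q" "q \<le> m + 1" and j: "j < ?n" and Wc: "W q j = c"
        using AD[OF that] by auto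
      \<comment> \<open>At the top level the equation for \<open>m + 1\<close> contains pooling and
        the one for \<open>m\<close> an arrival, so the increment is killed at rate
        \<open>\<omega> + lam\<close>.\<close>
      define up where "up = (if q \<le> m then lam * (W (q + 1) j - c) else - (\<omega> + lam) * c)"
      have up: "0 \<le> up"
      proof (cases "q \<le> m")
        case True
        then show ?thesis using j lam_pos c_le[of "q + 1" j] by (simp add: up_def)
      next
        case False
        have "0 \<le> - (\<omega> + lam) * c" using \<omega> lam_pos c by (intro mult_nonpos_nonpos) auto
        then show ?thesis using False by (simp add: up_def)
      qed
      define X where "X = (\<Sum>i\<in>{..<?n} - {j}. S $$ (j, i) * (W q i - c))"
      have X: "0 \<le> X"
        unfolding X_def using q j S_nonneg[OF j] c_le[of q]
        by (intro sum_nonneg mult_nonneg_nonneg) auto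
      define Y where "Y = (\<Sum>i<?n. \<alpha> $ i * (W (q - 1) i - c))"
      have Y: "0 \<le> Y"
        unfolding Y_def using q alpha_nonneg c_le[of "q - 1"]
        by (intro sum_nonneg mult_nonneg_nonneg) auto
      have dS: "(\<Sum>i<?n. S $$ (j, i) * U q i) - (\<Sum>i<?n. S $$ (j, i) * U (q - 1) i)
          = X - exit_vec S $ j * c"
      proof -
        have "(\<Sum>i<?n. S $$ (j, i) * U q i) - (\<Sum>i<?n. S $$ (j, i) * U (q - 1) i)
            = (\<Sum>i<?n. S $$ (j, i) * W q i)"
          by (simp add: W_def right_diff_distrib sum_subtractf)
        then show ?thesis
          using S_mult_diff[OF j, of "W q"] by (simp only: Wc X_def)
      qed
      have da: "(\<Sum>i<?n. \<alpha> $ i * U (q - 1) i) - (\<Sum>i<?n. \<alpha> $ i * U (q - 1 - 1) i) = Y + c"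
        using alpha_sum by (simp add: W_def Y_def right_diff_distrib sum_subtractf flip: sum_distrib_right)
      have q1: "q - 1 \<le> m" "q - 1 + 1 = q" using q by auto
      \<comment> \<open>The equations of levels \<open>q\<close> and \<open>q - 1\<close> are
        subtracted. The result is a sum of nonnegative contributions equal to zero, so those of
        phase changes and completions vanish.\<close>
      have "0 = drift m \<omega> U q j - drift m \<omega> U (q - 1) j"
        using drift[of q j] drift[of "q - 1" j] q j by simp
      also have "\<dots> = up + (1 - p) * (((\<Sum>i<?n. S $$ (j, i) * U q i) - (\<Sum>i<?n. S $$ (j, i) * U (q - 1) i))
          + exit_vec S $ j * ((\<Sum>i<?n. \<alpha> $ i * U (q - 1) i) - (\<Sum>i<?n. \<alpha> $ i * U (q - 1 - 1) i)))"
      proof (cases "q \<le> m")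
        case True
        then show ?thesis
          using q q1 unfolding drift_def up_def Wc[symmetric] by (simp add: W_def algebra_simps)
      next
        case False
        then have "q = m + 1" using q by simp
        then show ?thesis
          using q q1 unfolding drift_def up_def Wc[symmetric] by (simp add: W_def algebra_simps)
      qed
      also have "\<dots> = up + (1 - p) * (X + exit_vec S $ j * Y)"
        unfolding dS da by (simp add: algebra_simps)
      finally have "up + (1 - p) * (X + exit_vec S $ j * Y) = 0" by simp
      moreover have "0 \<le> exit_vec S $ j * Y" using Y exit_vec_nonneg[OF j] by simp
      ultimately have "(1 - p) * (X + exit_vec S $ j * Y) = 0"
        using up X p mult_nonneg_nonneg[of "1 - p" "X + exit_vec S $ j * Y"] by linarith
      then have "X + exit_vec S $ j * Y = 0" using p by simp
      then have "X = 0 \<and> exit_vec S $ j * Y = 0"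
        using X \<open>0 \<le> exit_vec S $ j * Y\<close> by linarith
      then show ?thesis by (simp add: X_def Y_def)
    qed
    show False
    proof (rule no_trap[of A])
      show "A \<noteq> {}" using qj0 by (auto simp: A_def)
      show "A \<subseteq> {1..} \<times> {..<?n}" by (auto simp: A_def D_def)
      show "exit_vec S $ j = 0" if "(1, j) \<in> A" for j using AD[OF that] by simp
      show "(q, i) \<in> A" if A: "(q, j) \<in> A" and i: "i < ?n" "i \<noteq> j" "0 < S $$ (j, i)" for q j i
      proof -
        have q: "2 \<le> q" "q \<le> m + 1" and j: "j < ?n" using AD[OF A] by auto
        have "\<forall>i\<in>{..<?n} - {j}. S $$ (j, i) * (W q i - c) = 0"
          using key[OF A] q j S_nonneg[OF j] c_le[of q]
          by (subst (asm) sum_nonneg_eq_0_iff) auto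
        then have "S $$ (j, i) * (W q i - c) = 0" using i by blast
        then have "W q i = c" using i by simp
        then show ?thesis using q i by (auto simp: A_def D_def)
      qed
      show "(q - 1, i) \<in> A"
        if A: "(q, j) \<in> A" and i: "i < ?n" "2 \<le> q" "0 < exit_vec S $ j" "0 < \<alpha> $ i" for q j i
      proof -
        have q: "2 \<le> q" "q \<le> m + 1" and j: "j < ?n" using AD[OF A] by auto
        have "(\<Sum>i<?n. \<alpha> $ i * (W (q - 1) i - c)) = 0" using key[OF A] i by simp
        then have "\<forall>i\<in>{..<?n}. \<alpha> $ i * (W (q - 1) i - c) = 0"
          using q alpha_nonneg c_le[of "q - 1"]
          by (subst (asm) sum_nonneg_eq_0_iff) auto
        then have "\<alpha> $ i * (W (q - 1) i - c) = 0" using i by blast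
        then have "W (q - 1) i = c" using i by simp
        then show ?thesis using q i by (auto simp: A_def D_def)
      qed
    qed
  qed
  then have "0 < W q j" using c_le[of q j] assms by linarith
  then show ?thesis by (simp add: W_def)
qed

section \<open>Comparison of chains with different parameters\<close>

lemma sum_top_level:
  fixes f :: "nat \<Rightarrow> nat \<Rightarrow> real"
  shows "(\<Sum>q=1..m + 1. \<Sum>j<n. f q j * (if q = m + 1 then g j else 0)) = (\<Sum>j<n. f (m + 1) j * g j)"
proof -
  have "(\<Sum>q=1..m + 1. \<Sum>j<n. f q j * (if q = m + 1 then g j else 0))
      = (\<Sum>q=1..m + 1. if q = m + 1 then (\<Sum>j<n. f (m + 1) j * g j) else 0)"
    by (intro sum.cong) auto
  also have "\<dots> = (\<Sum>j<n. f (m + 1) j * g j)" by (subst sum.delta) auto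
  finally show ?thesis .
qed

text \<open>The common device of the comparisons: emptying times of one chain, inserted into
  another, have drift \<open>-1\<close> except at the top level, and the error
  \<open>\<delta>\<close> is weighted with the stationary mass there.\<close>

lemma idle_perturbed_drift:
  assumes "0 \<le> \<omega>" "\<And>j. U 0 j = 0"
    and "\<And>q j. 1 \<le> q \<Longrightarrow> q \<le> m + 1 \<Longrightarrow> j < dim_vec \<alpha> \<Longrightarrow>
      drift m \<omega> U q j = -1 + (if q = m + 1 then \<delta> j else 0)"
  shows "idle m \<omega> * (1 + lam * (\<Sum>j<dim_vec \<alpha>. \<alpha> $ j * U 1 j)) =
    1 - (\<Sum>j<dim_vec \<alpha>. prob m \<omega> (Busy (m + 1) j) * \<delta> j)"
proof -
  let ?n = "dim_vec \<alpha>"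
  have "(\<Sum>q=1..m + 1. \<Sum>j<?n. prob m \<omega> (Busy q j) * drift m \<omega> U q j)
      = (\<Sum>q=1..m + 1. \<Sum>j<?n. prob m \<omega> (Busy q j) * (-1 + (if q = m + 1 then \<delta> j else 0)))"
    using assms(3) by (intro sum.cong refl) simp
  also have "\<dots> = - (\<Sum>q=1..m + 1. \<Sum>j<?n. prob m \<omega> (Busy q j))
      + (\<Sum>q=1..m + 1. \<Sum>j<?n. prob m \<omega> (Busy q j) * (if q = m + 1 then \<delta> j else 0))"
    by (simp only: distrib_left sum.distrib mult_minus_right mult_1_right sum_negf)
  also have "\<dots> = idle m \<omega> - 1 + (\<Sum>j<?n. prob m \<omega> (Busy (m + 1) j) * \<delta> j)"
    using stationary_sum[OF rp_stationary[OF assms(1)], of m] unfolding sum_top_level by linarith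
  finally show ?thesis
    using stationary_drift[OF rp_stationary[OF assms(1)], of U 0 m] assms(2)
    by (simp add: algebra_simps)
qed

text \<open>Only the top level notices the pooling rate: there the drift changes by
  \<open>- (\<omega>' - \<omega>)\<close> times an increment of \<open>U\<close>.\<close>

lemma idle_compare_rate:
  assumes U: "hitting_time m \<omega> U" and "0 \<le> \<omega>'"
  shows "idle m \<omega>' * (1 + lam * (\<Sum>j<dim_vec \<alpha>. \<alpha> $ j * U 1 j)) =
    1 + (\<omega>' - \<omega>) * (\<Sum>j<dim_vec \<alpha>. prob m \<omega>' (Busy (m + 1) j) * (U (m + 1) j - U m j))"
proof -
  have "drift m \<omega>' U q j = -1 + (if q = m + 1 then - (\<omega>' - \<omega>) * (U (m + 1) j - U m j) else 0)"
    if "1 \<le> q" "q \<le> m + 1" "j < dim_vec \<alpha>" for q j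
  proof -
    have "drift m \<omega>' U q j = drift m \<omega> U q j + (if q = m + 1 then - (\<omega>' - \<omega>) * (U (m + 1) j - U m j) else 0)"
      using that by (cases "q = m + 1") (simp_all add: drift_def algebra_simps)
    then show ?thesis using U that by (auto simp: hitting_time_def)
  qed
  then have "idle m \<omega>' * (1 + lam * (\<Sum>j<dim_vec \<alpha>. \<alpha> $ j * U 1 j)) =
    1 - (\<Sum>j<dim_vec \<alpha>. prob m \<omega>' (Busy (m + 1) j) * (- (\<omega>' - \<omega>) * (U (m + 1) j - U m j)))"
    using U assms(2) by (intro idle_perturbed_drift) (auto simp: hitting_time_def)
  also have "(\<Sum>j<dim_vec \<alpha>. prob m \<omega>' (Busy (m + 1) j) * (- (\<omega>' - \<omega>) * (U (m + 1) j - U m j)))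
      = - (\<omega>' - \<omega>) * (\<Sum>j<dim_vec \<alpha>. prob m \<omega>' (Busy (m + 1) j) * (U (m + 1) j - U m j))"
    unfolding sum_distrib_left by (intro sum.cong refl) (rule mult.left_commute)
  finally show ?thesis by (simp only: mult_minus_left diff_minus_eq_add)
qed

lemma idle_compare_level:
  assumes U: "hitting_time m 0 U" and \<omega>: "0 \<le> \<omega>"
  shows "idle (m + 1) \<omega> * (1 + lam * (\<Sum>j<dim_vec \<alpha>. \<alpha> $ j * U 1 j)) =
    1 - (\<Sum>j<dim_vec \<alpha>. prob (m + 1) \<omega> (Busy (m + 2) j) *
          ((1 - p) * exit_vec S $ j * (\<Sum>i<dim_vec \<alpha>. \<alpha> $ i * (U (m + 1) i - U m i))))"
proof -
  let ?n = "dim_vec \<alpha>"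
  \<comment> \<open>\<open>U\<close> is continued to level \<open>m + 2\<close> by its values at
    \<open>m + 1\<close>. Arrivals at level \<open>m + 1\<close> and pooling at \<open>m + 2\<close>
    then leave \<open>V\<close> unchanged, as if the buffer ended at \<open>m + 1\<close> without
    pooling. Only completions at level \<open>m + 2\<close> differ, leading to
    \<open>U (m + 1)\<close> instead of \<open>U m\<close>.\<close>
  define V where "V q = (if q \<le> m + 1 then U q else U (m + 1))" for q
  define \<delta> where "\<delta> j = (1 - p) * exit_vec S $ j * (\<Sum>i<?n. \<alpha> $ i * (U (m + 1) i - U m i))" for j
  have drift: "drift m 0 U q j = -1" if "1 \<le> q" "q \<le> m + 1" "j < ?n" for q j
    using U that by (auto simp: hitting_time_def)
  have perturbed: "drift (m + 1) \<omega> V q j = -1 + (if q = m + 1 + 1 then \<delta> j else 0)"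
    if q: "1 \<le> q" "q \<le> m + 1 + 1" and j: "j < ?n" for q j
  proof (cases "q \<le> m + 1")
    case True
    have "drift (m + 1) \<omega> V q j = drift m 0 U q j"
      using True by (cases "q = m + 1") (simp_all add: drift_def V_def)
    then show ?thesis using True drift q j by simp
  next
    case False
    then have q: "q = m + 2" using q by simp
    have "drift (m + 1) \<omega> V q j = drift m 0 U (m + 1) j + \<delta> j"
      by (simp add: q drift_def V_def \<delta>_def algebra_simps sum_subtractf)
    then show ?thesis using drift[of "m + 1" j] j q by simp
  qed
  have "V 0 j = 0" for j using U by (simp add: hitting_time_def V_def)
  then have "idle (m + 1) \<omega> * (1 + lam * (\<Sum>j<?n. \<alpha> $ j * V 1 j)) =
    1 - (\<Sum>j<?n. prob (m + 1) \<omega> (Busy (m + 1 + 1) j) * \<delta> j)"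
    using \<omega> perturbed by (intro idle_perturbed_drift)
  then show ?thesis by (simp add: V_def \<delta>_def)
qed

lemma hitting_time_factor_ge_1:
  assumes "hitting_time m \<omega> U"
  shows "1 \<le> 1 + lam * (\<Sum>j<dim_vec \<alpha>. \<alpha> $ j * U 1 j)"
  using assms lam_pos alpha_nonneg
  by (auto simp: hitting_time_def intro!: mult_nonneg_nonneg sum_nonneg)

text \<open>A renewal formula: idle periods have mean \<open>1 / lam\<close>, and the sum is the
  mean busy period.\<close>

lemma idle_hitting_time:
  assumes "hitting_time m \<omega> U" "0 \<le> \<omega>"
  shows "idle m \<omega> * (1 + lam * (\<Sum>j<dim_vec \<alpha>. \<alpha> $ j * U 1 j)) = 1"
  using idle_compare_rate[OF assms] by simp

lemma idle_pos:
  assumes "0 \<le> \<omega>"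
  shows "0 < idle m \<omega>"
proof -
  obtain U where "hitting_time m \<omega> U" using hitting_time_exists[OF assms] .
  from idle_hitting_time[OF this assms] show ?thesis
    using pmf_nonneg[of "rp_stationary lam p \<alpha> S m \<omega>" Empty] by (cases "idle m \<omega> = 0") auto
qed

lemma prob_pos_step:
  assumes "0 \<le> \<omega>" "0 < prob m \<omega> x" "x \<in> states m" "y \<in> states m" "0 < rate m \<omega> x y"
  shows "0 < prob m \<omega> y"
  using stationary_distribution_support[OF finite_rp_states rp_stationary[OF assms(1)]]
    rate_nonneg[OF assms(1)] assms(2-) by blast

lemma prob_Busy_pos_up:
  assumes "0 \<le> \<omega>" "0 < prob m \<omega> (Busy 1 j)" "j < dim_vec \<alpha>" "1 \<le> q" "q \<le> m + 1"
  shows "0 < prob m \<omega> (Busy q j)"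
  using assms(4,5)
proof (induction q rule: dec_induct)
  case base
  then show ?case using assms by simp
next
  case (step k)
  show ?case
    using step assms(1,3) lam_pos
    by (intro prob_pos_step[of \<omega> m "Busy k j" "Busy (Suc k) j"]) (auto simp: rp_states_def)
qed

lemma prob_top_pos:
  assumes "0 \<le> \<omega>"
  shows "\<exists>j<dim_vec \<alpha>. 0 < prob m \<omega> (Busy (m + 1) j)"
proof -
  obtain j where j: "j < dim_vec \<alpha>" "0 < \<alpha> $ j" using alpha_pos_exists by blast
  have "0 < prob m \<omega> (Busy 1 j)"
    using assms j idle_pos[OF assms] lam_pos
    by (intro prob_pos_step[of \<omega> m Empty "Busy 1 j"]) (auto simp: rp_states_def)
  then show ?thesis using prob_Busy_pos_up[OF assms _ j(1), of m "m + 1"] j by auto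
qed

text \<open>The top level carries mass and the increments of \<open>U\<close> are positive, so the
  correction in \<open>idle_compare_rate\<close> is strictly positive.\<close>

lemma idle_strict_mono:
  assumes "0 \<le> \<omega>" "\<omega> < \<omega>'"
  shows "idle m \<omega> < idle m \<omega>'"
proof -
  obtain U where U: "hitting_time m \<omega> U" using hitting_time_exists[OF assms(1)] .
  define F where "F = 1 + lam * (\<Sum>j<dim_vec \<alpha>. \<alpha> $ j * U 1 j)"
  have F: "1 \<le> F" unfolding F_def by (rule hitting_time_factor_ge_1[OF U])
  have W: "0 < U (m + 1) j - U m j" if "j < dim_vec \<alpha>" for j
    using hitting_time_increasing[OF assms(1) U, of "m + 1" j] that by simp
  obtain j where j: "j < dim_vec \<alpha>" "0 < prob m \<omega>' (Busy (m + 1) j)"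
    using prob_top_pos[of \<omega>' m] assms by auto
  have "0 < (\<Sum>j<dim_vec \<alpha>. prob m \<omega>' (Busy (m + 1) j) * (U (m + 1) j - U m j))"
    using j W by (intro sum_pos2[of _ j] mult_pos_pos mult_nonneg_nonneg) (auto simp: less_imp_le)
  then have "1 < idle m \<omega>' * F"
    using idle_compare_rate[OF U, of \<omega>'] assms by (simp add: F_def)
  then have "idle m \<omega> * F < idle m \<omega>' * F"
    using idle_hitting_time[OF U assms(1)] by (simp add: F_def)
  then show ?thesis using F by simp
qed

text \<open>Test function: the indicator of a busy system. As \<open>1 \<le> m\<close>, pooling
  never empties the queue, so completions alone balance the arrivals at the empty state. The
  identity supplies a phase with positive exit rate and mass at level 1.\<close>

lemma departures_from_one:
  assumes "0 \<le> \<omega>" "1 \<le> m"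
  shows "lam * idle m \<omega> = (1 - p) * (\<Sum>j<dim_vec \<alpha>. prob m \<omega> (Busy 1 j) * exit_vec S $ j)"
proof -
  let ?n = "dim_vec \<alpha>"
  define U where "U q j = (if q = 0 then 0 else 1 :: real)" for q j :: nat
  have "drift m \<omega> U q j = (if q = 1 then - (1 - p) * exit_vec S $ j else 0)"
    if "1 \<le> q" "q \<le> m + 1" "j < ?n" for q j
    using that assms alpha_sum by (auto simp: drift_def U_def exit_vec_eq algebra_simps)
  then have "(\<Sum>q=1..m + 1. \<Sum>j<?n. prob m \<omega> (Busy q j) * drift m \<omega> U q j)
      = (\<Sum>q=1..m + 1. \<Sum>j<?n. prob m \<omega> (Busy q j) * (if q = 1 then - (1 - p) * exit_vec S $ j else 0))"
    by (intro sum.cong refl) simp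
  also have "\<dots> = (\<Sum>q=1..m + 1. if q = 1 then \<Sum>j<?n. prob m \<omega> (Busy q j) * (- (1 - p) * exit_vec S $ j) else 0)"
    by (intro sum.cong) auto
  also have "\<dots> = - (1 - p) * (\<Sum>j<?n. prob m \<omega> (Busy 1 j) * exit_vec S $ j)"
    unfolding sum_distrib_left by (subst sum.delta) (auto intro!: sum.cong)
  finally show ?thesis
    using stationary_drift[OF rp_stationary[OF assms(1)], of U 0 m] alpha_sum
    by (simp add: U_def algebra_simps)
qed

lemma idle_Suc_less:
  assumes "0 \<le> \<omega>"
  shows "idle (m + 1) \<omega> < idle m 0"
proof -
  let ?n = "dim_vec \<alpha>"
  obtain U where U: "hitting_time m 0 U" using hitting_time_exists[of 0] by auto
  define F where "F = 1 + lam * (\<Sum>j<?n. \<alpha> $ j * U 1 j)"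
  have F: "1 \<le> F" unfolding F_def by (rule hitting_time_factor_ge_1[OF U])
  have p: "0 < 1 - p" using p_less_1 by simp
  have W: "0 < U (m + 1) j - U m j" if "j < ?n" for j
    using hitting_time_increasing[OF order_refl U, of "m + 1" j] that by simp
  define w where "w = (\<Sum>i<?n. \<alpha> $ i * (U (m + 1) i - U m i))"
  obtain i where "i < ?n" "0 < \<alpha> $ i" using alpha_pos_exists by blast
  then have w: "0 < w"
    unfolding w_def using W alpha_nonneg
    by (intro sum_pos2[of _ i] mult_pos_pos mult_nonneg_nonneg) (auto simp: less_imp_le)
  \<comment> \<open>Strictness requires mass at the top level in a phase with positive exit rate.
    Such a phase carries mass at level 1, and arrivals, which keep the phase, carry it to the
    top.\<close>
  have "0 < (1 - p) * (\<Sum>j<?n. prob (m + 1) \<omega> (Busy 1 j) * exit_vec S $ j)"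
    using departures_from_one[OF assms, of "m + 1", symmetric] idle_pos[OF assms, of "m + 1"] lam_pos
    by (simp only: le_add2 mult_pos_pos)
  then have "0 < (\<Sum>j<?n. prob (m + 1) \<omega> (Busy 1 j) * exit_vec S $ j)"
    using p by (simp add: zero_less_mult_iff)
  then obtain j where j: "j < ?n" "0 < prob (m + 1) \<omega> (Busy 1 j) * exit_vec S $ j"
    by (metis (no_types, lifting) lessThan_iff not_less sum_nonpos)
  then have j': "0 < prob (m + 1) \<omega> (Busy 1 j)" "0 < exit_vec S $ j"
    using exit_vec_nonneg[of j] pmf_nonneg[of "rp_stationary lam p \<alpha> S (m + 1) \<omega>" "Busy 1 j"]
    by (auto simp: zero_less_mult_iff)
  have "0 < prob (m + 1) \<omega> (Busy (m + 2) j)"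
    using prob_Busy_pos_up[OF assms j'(1) j(1), of "m + 2"] by simp
  then have "0 < (\<Sum>j<?n. prob (m + 1) \<omega> (Busy (m + 2) j) * ((1 - p) * exit_vec S $ j * w))"
    using j j' p w exit_vec_nonneg
    by (intro sum_pos2[of _ j] mult_pos_pos mult_nonneg_nonneg) auto
  then have "idle (m + 1) \<omega> * F < 1"
    using idle_compare_level[OF U assms] by (simp add: F_def w_def)
  then have "idle (m + 1) \<omega> * F < idle m 0 * F"
    using idle_hitting_time[OF U] by (simp add: F_def)
  then show ?thesis using F by simp
qed

section \<open>Order of the pairs of buffer size and pooling rate\<close>

lemma idle_mono: "0 \<le> \<omega> \<Longrightarrow> \<omega> \<le> \<omega>' \<Longrightarrow> idle m \<omega> \<le> idle m \<omega>'"
  using idle_strict_mono[of \<omega> \<omega>' m] by (cases "\<omega> = \<omega>'") auto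

lemma idle_less_level:
  assumes "0 \<le> \<omega>" "0 \<le> \<omega>'" "m < m'"
  shows "idle m' \<omega>' < idle m \<omega>"
  using assms(3,2)
proof (induction m' arbitrary: \<omega>')
  case (Suc k)
  have 1: "idle (Suc k) \<omega>' < idle k 0" using idle_Suc_less[OF Suc.prems(2), of k] by simp
  have 2: "idle m 0 \<le> idle m \<omega>" using idle_mono[of 0 \<omega>] assms(1) by simp
  show ?case
  proof (cases "m = k")
    case False
    then show ?thesis using Suc.IH[of 0] Suc.prems 1 by simp
  qed (use 1 2 in simp)
qed simp

lemma idle_inj:
  assumes "0 \<le> \<omega>" "0 \<le> \<omega>'" "idle m \<omega> = idle m' \<omega>'"
  shows "m = m' \<and> \<omega> = \<omega>'"
proof -
  have "m = m'"
    using idle_less_level[of \<omega> \<omega>' m m'] idle_less_level[of \<omega>' \<omega> m' m] assms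
    by (cases m m' rule: linorder_cases) auto
  then show ?thesis
    using idle_strict_mono[of \<omega> \<omega>' m] idle_strict_mono[of \<omega>' \<omega> m] assms
    by (cases \<omega> \<omega>' rule: linorder_cases) auto
qed

lemma cavity_params_eqI:
  assumes "0 \<le> \<omega>" "idle m \<omega> = (1 - lam) / (1 - p)"
  shows "cavity_params lam p \<alpha> S = (m, \<omega>)"
  unfolding cavity_params_def
proof (rule the_equality)
  show "case (m, \<omega>) of (m, \<omega>) \<Rightarrow> 0 \<le> \<omega> \<and> idle m \<omega> = (1 - lam) / (1 - p)"
    using assms by simp
  fix x assume "case x of (m, \<omega>) \<Rightarrow> 0 \<le> \<omega> \<and> idle m \<omega> = (1 - lam) / (1 - p)"
  then show "x = (m, \<omega>)" using idle_inj[of "snd x" \<omega> "fst x" m] assms by (cases x) auto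
qed

subsection \<open>Values of the idle probability\<close>

lemma sum_Busy:
  assumes "0 \<le> \<omega>"
  shows "(\<Sum>q=1..m + 1. \<Sum>j<dim_vec \<alpha>. prob m \<omega> (Busy q j)) = 1 - idle m \<omega>"
  using stationary_sum[OF rp_stationary[OF assms], of m] by linarith

text \<open>Test function: the indicator of the top level. The flow out of it by pooling cannot
  exceed the arrival rate, so its mass vanishes as \<open>\<omega>\<close> grows.\<close>

lemma pooling_rate_mass:
  assumes "0 \<le> \<omega>"
  shows "\<omega> * (\<Sum>j<dim_vec \<alpha>. prob m \<omega> (Busy (m + 1) j)) \<le> lam"
proof -
  let ?n = "dim_vec \<alpha>"
  define U where "U q j = (if q = m + 1 then 1 else 0 :: real)" for q j :: nat
  have p: "0 \<le> 1 - p" using p_less_1 by simp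
  have "drift m \<omega> U q j \<le> lam + (if q = m + 1 then - \<omega> else 0)"
    if "1 \<le> q" "q \<le> m + 1" "j < ?n" for q j
  proof (cases "q = m + 1")
    case True
    have "drift m \<omega> U q j = - \<omega> - (1 - p) * exit_vec S $ j"
      using True that by (simp add: drift_def U_def exit_vec_eq algebra_simps)
    then show ?thesis
      using True p lam_pos mult_nonneg_nonneg[OF p exit_vec_nonneg[OF that(3)]] by simp
  next
    case False
    then have "drift m \<omega> U q j = lam * U (q + 1) j"
      using that by (simp add: drift_def U_def)
    then show ?thesis using False lam_pos by (simp add: U_def)
  qed
  then have "(\<Sum>q=1..m + 1. \<Sum>j<?n. prob m \<omega> (Busy q j) * drift m \<omega> U q j)
      \<le> (\<Sum>q=1..m + 1. \<Sum>j<?n. prob m \<omega> (Busy q j) * (lam + (if q = m + 1 then - \<omega> else 0)))"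
    by (intro sum_mono mult_left_mono) auto
  also have "\<dots> = lam * (\<Sum>q=1..m + 1. \<Sum>j<?n. prob m \<omega> (Busy q j))
      + (\<Sum>q=1..m + 1. \<Sum>j<?n. prob m \<omega> (Busy q j) * (if q = m + 1 then - \<omega> else 0))"
    unfolding distrib_left sum.distrib sum_distrib_left by (simp only: mult.commute)
  also have "\<dots> = lam * (1 - idle m \<omega>) - \<omega> * (\<Sum>j<?n. prob m \<omega> (Busy (m + 1) j))"
    unfolding sum_top_level sum_Busy[OF assms] sum_distrib_right[symmetric] by simp
  finally have le: "(\<Sum>q=1..m + 1. \<Sum>j<?n. prob m \<omega> (Busy q j) * drift m \<omega> U q j)
      \<le> lam * (1 - idle m \<omega>) - \<omega> * (\<Sum>j<?n. prob m \<omega> (Busy (m + 1) j))" .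
  \<comment> \<open>For \<open>m = 0\<close> the top level is entered from \<open>Empty\<close>.
    Bounding this entry by \<open>lam\<close> times the idle mass completes \<open>lam\<close> times
    the busy mass to \<open>lam\<close>.\<close>
  have "(\<Sum>j<?n. \<alpha> $ j * U 1 j) \<le> (\<Sum>j<?n. \<alpha> $ j * 1)"
    using alpha_nonneg by (intro sum_mono mult_left_mono) (auto simp: U_def)
  then have "idle m \<omega> * (lam * ((\<Sum>j<?n. \<alpha> $ j * U 1 j) - 0)) \<le> idle m \<omega> * (lam * 1)"
    using alpha_sum lam_pos by (intro mult_left_mono) auto
  then show ?thesis
    using le stationary_drift[OF rp_stationary[OF assms], of U 0 m]
    by (simp add: U_def algebra_simps)
qed

text \<open>\<open>U\<close> belongs to the fixed rate \<open>\<omega>\<close> while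
  \<open>\<omega>'\<close> varies in \<open>idle_compare_rate\<close>. The sum there is at most
  \<open>K\<close>, so the change of \<open>idle\<close> is at most \<open>K\<close> times the
  change of the rate.\<close>

lemma continuous_on_idle: "continuous_on {0..} (idle m)"
  unfolding continuous_on_def
proof
  fix \<omega> :: real assume "\<omega> \<in> {0..}"
  then have \<omega>: "0 \<le> \<omega>" by simp
  let ?n = "dim_vec \<alpha>"
  obtain U where U: "hitting_time m \<omega> U" using hitting_time_exists[OF \<omega>] .
  define F where "F = 1 + lam * (\<Sum>j<?n. \<alpha> $ j * U 1 j)"
  have F: "1 \<le> F" unfolding F_def by (rule hitting_time_factor_ge_1[OF U])
  define K where "K = (\<Sum>j<?n. U (m + 1) j - U m j)"
  have W: "0 \<le> U (m + 1) j - U m j" if "j < ?n" for j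
    using hitting_time_increasing[OF \<omega> U, of "m + 1" j] that by simp
  have bound: "norm (idle m \<omega>' - idle m \<omega>) \<le> \<bar>\<omega>' - \<omega>\<bar> * K" if "0 \<le> \<omega>'" for \<omega>'
  proof -
    define E where "E = (\<Sum>j<?n. prob m \<omega>' (Busy (m + 1) j) * (U (m + 1) j - U m j))"
    have "0 \<le> E"
      unfolding E_def by (intro sum_nonneg mult_nonneg_nonneg pmf_nonneg W) simp
    moreover have "E \<le> K"
      unfolding E_def K_def
    proof (rule sum_mono)
      fix j assume "j \<in> {..<?n}"
      then show "prob m \<omega>' (Busy (m + 1) j) * (U (m + 1) j - U m j) \<le> U (m + 1) j - U m j"
        using mult_left_le_one_le[OF W[of j] pmf_nonneg pmf_le_1] by simp
    qed
    ultimately have E: "0 \<le> E" "E \<le> K" .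
    have "(idle m \<omega>' - idle m \<omega>) * F = (\<omega>' - \<omega>) * E"
      using idle_compare_rate[OF U that] idle_hitting_time[OF U \<omega>]
      by (simp add: F_def E_def left_diff_distrib)
    then have "\<bar>(idle m \<omega>' - idle m \<omega>) * F\<bar> = \<bar>(\<omega>' - \<omega>) * E\<bar>" by (rule arg_cong)
    moreover have "\<bar>F\<bar> = F" "\<bar>E\<bar> = E" using F E by simp_all
    ultimately have "\<bar>idle m \<omega>' - idle m \<omega>\<bar> * F = \<bar>\<omega>' - \<omega>\<bar> * E"
      by (simp only: abs_mult)
    moreover have "\<bar>idle m \<omega>' - idle m \<omega>\<bar> * 1 \<le> \<bar>idle m \<omega>' - idle m \<omega>\<bar> * F"
      using F by (intro mult_left_mono) auto
    moreover have "\<bar>\<omega>' - \<omega>\<bar> * E \<le> \<bar>\<omega>' - \<omega>\<bar> * K"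
      using E by (intro mult_left_mono) auto
    ultimately show ?thesis by simp
  qed
  have "((\<lambda>\<omega>'. \<bar>\<omega>' - \<omega>\<bar> * K) \<longlongrightarrow> \<bar>\<omega> - \<omega>\<bar> * K) (at \<omega> within {0..})"
    by (intro tendsto_intros)
  then have "((\<lambda>\<omega>'. \<bar>\<omega>' - \<omega>\<bar> * K) \<longlongrightarrow> 0) (at \<omega> within {0..})" by simp
  moreover have "\<forall>\<^sub>F \<omega>' in at \<omega> within {0..}. norm (idle m \<omega>' - idle m \<omega>) \<le> \<bar>\<omega>' - \<omega>\<bar> * K"
    unfolding eventually_at_filter by (rule always_eventually) (use bound in simp)
  ultimately have "((\<lambda>\<omega>'. idle m \<omega>' - idle m \<omega>) \<longlongrightarrow> 0) (at \<omega> within {0..})"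
    by (rule Lim_null_comparison[rotated])
  then show "(idle m \<longlongrightarrow> idle m \<omega>) (at \<omega> within {0..})"
    by (rule LIM_zero_cancel)
qed

lemma idle_0_large_rate:
  assumes "g < 1"
  shows "\<exists>\<omega>\<ge>0. g < idle 0 \<omega>"
proof -
  \<comment> \<open>Chosen such that \<open>lam < \<omega> * (1 - g)\<close>; for
    \<open>m = 0\<close> the top level carries the whole busy mass.\<close>
  define \<omega> where "\<omega> = 2 * lam / (1 - g)"
  have \<omega>: "0 < \<omega>" using assms lam_pos by (simp add: \<omega>_def)
  have "\<omega> * (1 - idle 0 \<omega>) \<le> lam"
    using pooling_rate_mass[of \<omega> 0] sum_Busy[of \<omega> 0] \<omega> by simp
  also have "lam < \<omega> * (1 - g)" using assms lam_pos by (simp add: \<omega>_def)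
  finally have "g < idle 0 \<omega>" using \<omega> by simp
  then show ?thesis using \<omega> by (intro exI[of _ \<omega>]) simp
qed

text \<open>By \<open>idle_compare_level\<close> the gap below \<open>idle m 0\<close> is at most a
  constant times the mass of level \<open>m + 2\<close>, which \<open>pooling_rate_mass\<close>
  bounds by \<open>lam / \<omega>\<close>.\<close>

lemma idle_Suc_large_rate:
  assumes "g < idle m 0"
  shows "\<exists>\<omega>\<ge>0. g < idle (m + 1) \<omega>"
proof -
  let ?n = "dim_vec \<alpha>"
  obtain U where U: "hitting_time m 0 U" using hitting_time_exists[of 0] by auto
  define F where "F = 1 + lam * (\<Sum>j<?n. \<alpha> $ j * U 1 j)"
  have F: "1 \<le> F" unfolding F_def by (rule hitting_time_factor_ge_1[OF U])
  have p: "0 < 1 - p" using p_less_1 by simp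
  have W: "0 < U (m + 1) j - U m j" if "j < ?n" for j
    using hitting_time_increasing[OF order_refl U, of "m + 1" j] that by simp
  define w where "w j = (1 - p) * exit_vec S $ j * (\<Sum>i<?n. \<alpha> $ i * (U (m + 1) i - U m i))" for j
  have w: "0 \<le> w j" if "j < ?n" for j
    unfolding w_def using W alpha_nonneg p exit_vec_nonneg that
    by (intro mult_nonneg_nonneg sum_nonneg) (auto simp: less_imp_le)
  define K where "K = (\<Sum>j<?n. w j)"
  have K: "0 \<le> K" unfolding K_def using w by (intro sum_nonneg) auto
  have wK: "w j \<le> K" if "j < ?n" for j
    unfolding K_def using that w by (intro member_le_sum) auto
  \<comment> \<open>Makes \<open>K * lam / \<omega>\<close> smaller than
    \<open>idle m 0 - g\<close>; the summand \<open>1\<close> keeps \<open>\<omega>\<close> positive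
    if \<open>K = 0\<close>.\<close>
  define \<omega> where "\<omega> = (K * lam + 1) / (idle m 0 - g)"
  have \<omega>: "0 < \<omega>" unfolding \<omega>_def using assms K lam_pos by (intro divide_pos_pos add_nonneg_pos) auto
  define E where "E = (\<Sum>j<?n. prob (m + 1) \<omega> (Busy (m + 2) j) * w j)"
  define t where "t = (\<Sum>j<?n. prob (m + 1) \<omega> (Busy (m + 2) j))"
  have "E \<le> (\<Sum>j<?n. prob (m + 1) \<omega> (Busy (m + 2) j) * K)"
    unfolding E_def using wK by (intro sum_mono mult_left_mono) auto
  then have "E \<le> K * t" by (simp add: t_def sum_distrib_left mult.commute)
  then have "\<omega> * E \<le> K * (\<omega> * t)"
    using mult_left_mono[of E "K * t" \<omega>] \<omega> by (simp add: mult.left_commute)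
  also have "\<dots> \<le> K * lam"
    using pooling_rate_mass[of \<omega> "m + 1"] \<omega> K by (intro mult_left_mono) (auto simp: t_def)
  also have "\<dots> < \<omega> * (idle m 0 - g)" using assms by (simp add: \<omega>_def)
  finally have E: "E < idle m 0 - g" using \<omega> by simp
  have E0: "0 \<le> E" unfolding E_def using w by (intro sum_nonneg mult_nonneg_nonneg) auto
  have "(idle m 0 - idle (m + 1) \<omega>) * F = E"
    using idle_compare_level[OF U, of \<omega>] idle_hitting_time[OF U] \<omega>
    by (simp add: F_def E_def w_def left_diff_distrib)
  moreover have "idle m 0 - idle (m + 1) \<omega> \<le> (idle m 0 - idle (m + 1) \<omega>) * F"
    using mult_left_mono[OF F, of "idle m 0 - idle (m + 1) \<omega>"] idle_Suc_less[of \<omega> m] \<omega> by simp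
  ultimately have "idle m 0 - idle (m + 1) \<omega> \<le> E" by simp
  then have "g < idle (m + 1) \<omega>" using E by linarith
  then show ?thesis using \<omega> by (intro exI[of _ \<omega>]) simp
qed

text \<open>For the least \<open>k\<close> with \<open>idle k 0 \<le> g\<close>, minimality puts
  \<open>g\<close> below \<open>idle (k - 1) 0\<close>, or below 1 if \<open>k = 0\<close>. A large
  pooling rate then overshoots \<open>g\<close>, and the intermediate value theorem applies.\<close>

lemma idle_surj:
  assumes "g < 1" "idle m 0 \<le> g"
  shows "\<exists>k \<omega>. k \<le> m \<and> 0 \<le> \<omega> \<and> idle k \<omega> = g"
proof -
  define k where "k = (LEAST k. idle k 0 \<le> g)"
  have k: "idle k 0 \<le> g" "k \<le> m"
    unfolding k_def by (rule LeastI[of "\<lambda>k. idle k 0 \<le> g"], rule assms(2))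
      (rule Least_le[of "\<lambda>k. idle k 0 \<le> g"], rule assms(2))
  have "\<exists>\<omega>\<ge>0. g < idle k \<omega>"
  proof (cases k)
    case 0
    then show ?thesis using idle_0_large_rate[OF assms(1)] by simp
  next
    case (Suc l)
    then have "\<not> idle l 0 \<le> g"
      unfolding k_def by (intro not_less_Least) simp
    then show ?thesis using idle_Suc_large_rate[of g l] Suc by simp
  qed
  then obtain b where b: "0 \<le> b" "g < idle k b" by blast
  have "continuous_on {0..b} (idle k)"
    by (rule continuous_on_subset[OF continuous_on_idle]) auto
  then have "\<exists>\<omega>\<ge>0. \<omega> \<le> b \<and> idle k \<omega> = g"
    by (rule IVT'[of "idle k" 0 g b, OF k(1) less_imp_le[OF b(2)] b(1)])
  then show ?thesis using k by blast
qed

text \<open>Work balance, tested with the mean remaining size: an arrival at the empty system brings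
  mean work one, and work is served at rate \<open>1 - p\<close> in busy states.\<close>

lemma idle_0_0: "idle 0 0 = 1 / (1 + lam / (1 - p))"
proof -
  let ?n = "dim_vec \<alpha>"
  obtain h where h: "\<And>j. j < ?n \<Longrightarrow> (\<Sum>i<?n. S $$ (j, i) * h i) = -1"
    "(\<Sum>j<?n. \<alpha> $ j * h j) = 1"
    using phase_mean_exists by blast
  define U where "U q j = (if q = 0 then 0 else h j)" for q j :: nat
  have "drift 0 0 U 1 j = - (1 - p)" if "j < ?n" for j
    using h(1)[OF that] by (simp add: drift_def U_def)
  then have "(\<Sum>j<?n. prob 0 0 (Busy 1 j) * drift 0 0 U 1 j) = (\<Sum>j<?n. prob 0 0 (Busy 1 j) * - (1 - p))"
    by (intro sum.cong refl) simp
  also have "\<dots> = - ((1 - p) * (\<Sum>j<?n. prob 0 0 (Busy 1 j)))"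
    unfolding sum_distrib_right[symmetric] by (simp only: mult_minus_right mult.commute)
  finally have "idle 0 0 * lam = (1 - p) * (\<Sum>j<?n. prob 0 0 (Busy 1 j))"
    using stationary_drift[OF rp_stationary, of 0 U 0 0] h(2) by (simp add: U_def)
  also have "(\<Sum>j<?n. prob 0 0 (Busy 1 j)) = 1 - idle 0 0"
    using sum_Busy[OF order_refl, of 0] by simp
  finally show ?thesis using p_less_1 lam_pos by (simp add: field_simps add_pos_pos)
qed

section \<open>Long queues without pooling\<close>

text \<open>The test functions are chosen such that the service completions contribute only their mean rate:
  adding \<open>D q * h j\<close>, where \<open>h j\<close> is the expected remaining size of a job in phase \<open>j\<close>, to the
  antiderivative of \<open>D\<close> cancels the terms with \<open>exit_vec S\<close>.\<close>

lemma stationary_level_test: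
  fixes D :: "nat \<Rightarrow> real"
  assumes h: "\<And>j. j < dim_vec \<alpha> \<Longrightarrow> (\<Sum>i<dim_vec \<alpha>. S $$ (j, i) * h i) = -1"
    "(\<Sum>j<dim_vec \<alpha>. \<alpha> $ j * h j) = 1"
  shows "lam * idle m 0 * D 1 + (\<Sum>q=1..m + 1. \<Sum>j<dim_vec \<alpha>. prob m 0 (Busy q j) *
      (if q \<le> m then (lam - (1 - p)) * D q + lam * (h j * (D (q + 1) - D q)) else - (1 - p) * D (m + 1))) = 0"
proof -
  let ?n = "dim_vec \<alpha>"
  define \<phi> where "\<phi> q = (\<Sum>i<q. D i)" for q
  \<comment> \<open>Level 0 gets \<open>\<phi> 1\<close> instead of \<open>\<phi> 0\<close>, since
    no job in service contributes \<open>D 0\<close> there. The mean value after a completion at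
    level \<open>q\<close> is thus \<open>\<phi> q\<close> also for \<open>q = 1\<close>.\<close>
  define U where "U q j = (if q = 0 then \<phi> 1 else \<phi> q + D q * h j)" for q j
  have av: "(\<Sum>i<?n. \<alpha> $ i * (a + b * h i)) = a + b" for a b
    using alpha_sum h(2)
    by (simp add: distrib_left sum.distrib mult.left_commute sum_distrib_left[symmetric] sum_distrib_right[symmetric])
  have drift: "drift m 0 U q j =
      (if q \<le> m then (lam - (1 - p)) * D q + lam * (h j * (D (q + 1) - D q)) else - (1 - p) * D (m + 1))"
    if q: "1 \<le> q" "q \<le> m + 1" and j: "j < ?n" for q j
  proof -
    have down: "(\<Sum>i<?n. \<alpha> $ i * U (q - 1) i) = \<phi> q"
    proof (cases "q = 1")
      case True
      then show ?thesis using av[of "\<phi> 1" 0] by (simp add: U_def)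
    next
      case False
      then have "\<phi> q = \<phi> (q - 1) + D (q - 1)"
        using q by (cases q) (auto simp: \<phi>_def)
      then show ?thesis using q False av[of "\<phi> (q - 1)" "D (q - 1)"] by (simp add: U_def)
    qed
    have phase: "(\<Sum>i<?n. S $$ (j, i) * U q i) = - exit_vec S $ j * \<phi> q - D q"
    proof -
      have "(\<Sum>i<?n. S $$ (j, i) * U q i) = (\<Sum>i<?n. S $$ (j, i)) * \<phi> q + D q * (\<Sum>i<?n. S $$ (j, i) * h i)"
        using q by (simp add: U_def distrib_left sum.distrib sum_distrib_left sum_distrib_right mult.left_commute)
      then show ?thesis using h(1)[OF j] by (simp add: exit_vec_eq[OF j])
    qed
    have up: "U (q + 1) j - U q j = D q + h j * (D (q + 1) - D q)"
      using q by (simp add: U_def \<phi>_def algebra_simps)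
    show ?thesis
    proof (cases "q \<le> m")
      case True
      then show ?thesis unfolding drift_def down phase up by (simp add: algebra_simps)
    next
      case False
      then have "q = m + 1" using q by simp
      then show ?thesis unfolding drift_def down phase by (simp add: algebra_simps)
    qed
  qed
  have "(\<Sum>q=1..m + 1. \<Sum>j<?n. prob m 0 (Busy q j) * drift m 0 U q j) = (\<Sum>q=1..m + 1. \<Sum>j<?n. prob m 0 (Busy q j) *
      (if q \<le> m then (lam - (1 - p)) * D q + lam * (h j * (D (q + 1) - D q)) else - (1 - p) * D (m + 1)))"
    by (intro sum.cong refl) (simp add: drift)
  moreover have "(\<Sum>j<?n. \<alpha> $ j * U 1 j) - \<phi> 1 = D 1"
    using av[of "\<phi> 1" "D 1"] by (simp add: U_def)
  moreover have "U 0 i = \<phi> 1" for i by (simp add: U_def)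
  ultimately show ?thesis
    using stationary_drift[OF rp_stationary, of 0 U "\<phi> 1" m] by (simp add: algebra_simps)
qed

text \<open>Work balance for a longer buffer: jobs of mean size one are accepted only below the top
  level.\<close>

lemma stationary_throughput:
  "lam * (1 - (\<Sum>j<dim_vec \<alpha>. prob m 0 (Busy (m + 1) j))) = (1 - p) * (1 - idle m 0)"
proof -
  let ?n = "dim_vec \<alpha>"
  obtain h where h: "\<And>j. j < ?n \<Longrightarrow> (\<Sum>i<?n. S $$ (j, i) * h i) = -1"
    "(\<Sum>j<?n. \<alpha> $ j * h j) = 1"
    using phase_mean_exists by blast
  have "(\<Sum>q=1..m + 1. \<Sum>j<?n. prob m 0 (Busy q j) *
      (if q \<le> m then (lam - (1 - p)) * 1 + lam * (h j * (1 - 1)) else - (1 - p) * 1))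
    = (\<Sum>q=1..m + 1. \<Sum>j<?n. prob m 0 (Busy q j) * (lam - (1 - p)) + prob m 0 (Busy q j) * (if q = m + 1 then - lam else 0))"
    by (intro sum.cong refl) (auto simp: algebra_simps)
  also have "\<dots> = (1 - idle m 0) * (lam - (1 - p)) - lam * (\<Sum>j<?n. prob m 0 (Busy (m + 1) j))"
    unfolding sum.distrib sum_top_level sum_distrib_right[symmetric] sum_Busy[OF order_refl] by simp
  finally show ?thesis
    using stationary_level_test[OF h, of m "\<lambda>_. 1"] by (simp add: algebra_simps)
qed

text \<open>If \<open>lam \<le> 1 - p\<close>, the weights \<open>D q = q\<close> show that the top
  level, hence the loss, becomes negligible for large \<open>m\<close>. Otherwise the queue is
  overloaded, and weights decreasing linearly to zero at the top show that \<open>idle m 0\<close>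
  is of order \<open>1 / m\<close>.\<close>

lemma idle_small:
  assumes "0 < p" "lam < 1"
  shows "\<exists>m. idle m 0 \<le> (1 - lam) / (1 - p)"
proof -
  let ?n = "dim_vec \<alpha>"
  have p: "0 < 1 - p" using p_less_1 by simp
  obtain h where h: "\<And>j. j < ?n \<Longrightarrow> (\<Sum>i<?n. S $$ (j, i) * h i) = -1"
    "(\<Sum>j<?n. \<alpha> $ j * h j) = 1"
    using phase_mean_exists by blast
  define H where "H = (\<Sum>j<?n. \<bar>h j\<bar>)"
  have H: "\<bar>h j\<bar> \<le> H" if "j < ?n" for j
    unfolding H_def using that by (intro member_le_sum) auto
  have H0: "0 \<le> H" by (simp add: H_def sum_nonneg)
  note busy = sum_Busy[OF order_refl]
  show ?thesis
  proof (cases "lam \<le> 1 - p")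
    case True
    \<comment> \<open>The mass \<open>t\<close> of the top level will be at most
      \<open>lam * (1 + H) / ((1 - p) * (real m + 1))\<close>. This \<open>m\<close> ensures
      \<open>lam * t \<le> p\<close>, which \<open>stationary_throughput\<close> turns into the
      claim.\<close>
    obtain m :: nat where m: "lam * (lam * (1 + H)) / ((1 - p) * p) \<le> real m"
      using real_arch_simple by blast
    define t where "t = (\<Sum>j<?n. prob m 0 (Busy (m + 1) j))"
    have "(if q \<le> m then (lam - (1 - p)) * real q + lam * (h j * (real (q + 1) - real q)) else - (1 - p) * real (m + 1))
        \<le> lam * H + (if q = m + 1 then - ((1 - p) * (real m + 1)) else 0)"
      if "1 \<le> q" "q \<le> m + 1" "j < ?n" for q j
    proof (cases "q \<le> m")
      case True
      have "(lam - (1 - p)) * real q \<le> 0"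
        using \<open>lam \<le> 1 - p\<close> by (intro mult_nonpos_nonneg) auto
      moreover have "lam * h j \<le> lam * H" using H[OF that(3)] lam_pos by (intro mult_left_mono) auto
      ultimately show ?thesis using True by simp
    next
      case False
      then show ?thesis using that H0 lam_pos by (simp add: algebra_simps)
    qed
    then have "(\<Sum>q=1..m + 1. \<Sum>j<?n. prob m 0 (Busy q j) *
        (if q \<le> m then (lam - (1 - p)) * real q + lam * (h j * (real (q + 1) - real q)) else - (1 - p) * real (m + 1)))
      \<le> (\<Sum>q=1..m + 1. \<Sum>j<?n. prob m 0 (Busy q j) *
        (lam * H + (if q = m + 1 then - ((1 - p) * (real m + 1)) else 0)))"
      by (intro sum_mono mult_left_mono) auto
    also have "\<dots> = (1 - idle m 0) * (lam * H) - (1 - p) * (real m + 1) * t"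
      unfolding distrib_left[of "prob m 0 x" for x] sum.distrib sum_top_level
        sum_distrib_right[symmetric] busy by (simp add: t_def)
    finally have "(1 - p) * (real m + 1) * t \<le> lam * idle m 0 + (1 - idle m 0) * (lam * H)"
      using stationary_level_test[OF h, of m real] by simp
    also have "\<dots> \<le> lam * 1 + 1 * (lam * H)"
      using lam_pos H0 pmf_le_1[of "rp_stationary lam p \<alpha> S m 0" Empty]
      by (intro add_mono mult_left_mono mult_right_mono) auto
    finally have "(1 - p) * (real m + 1) * t \<le> lam * (1 + H)"
      by (simp add: distrib_left)
    then have "lam * ((1 - p) * (real m + 1) * t) \<le> lam * (lam * (1 + H))"
      using lam_pos by (intro mult_left_mono) auto
    also have "\<dots> \<le> (1 - p) * p * real m"
      using m p assms by (simp add: divide_le_eq mult.commute)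
    also have "\<dots> \<le> (1 - p) * p * (real m + 1)"
      using p assms by (intro mult_left_mono) auto
    finally have "(1 - p) * (real m + 1) * (lam * t) \<le> (1 - p) * (real m + 1) * p"
      by (simp only: ac_simps)
    then have "lam * t \<le> p" using p by (subst (asm) mult_le_cancel_left_pos) auto
    then have "(1 - p) * idle m 0 \<le> 1 - lam"
      using stationary_throughput[of m] by (simp add: t_def algebra_simps)
    then show ?thesis using p by (intro exI[of _ m]) (simp add: pos_le_divide_eq mult.commute)
  next
    case False
    define g where "g = (1 - lam) / (1 - p)"
    have g: "0 < g" using assms p by (simp add: g_def)
    obtain m :: nat where m: "H / g \<le> real m"
      using real_arch_simple by blast
    \<comment> \<open>The weight \<open>real m + 1 - real q\<close> vanishes at the top level and
      drops by one per level, so only the remaining size can contribute negatively. At level 1 it is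
      \<open>m\<close>, the factor of \<open>idle m 0\<close> below.\<close>
    have "- (lam * H) \<le> (if q \<le> m then (lam - (1 - p)) * (real m + 1 - real q) +
          lam * (h j * ((real m + 1 - real (q + 1)) - (real m + 1 - real q)))
        else - (1 - p) * (real m + 1 - real (m + 1)))"
      if "1 \<le> q" "q \<le> m + 1" "j < ?n" for q j
    proof (cases "q \<le> m")
      case True
      have "0 \<le> (lam - (1 - p)) * (real m + 1 - real q)"
        using False True by (intro mult_nonneg_nonneg) auto
      moreover have "lam * h j \<le> lam * H" using H[OF that(3)] lam_pos by (intro mult_left_mono) auto
      ultimately show ?thesis using True by simp
    next
      case False
      then show ?thesis using H0 lam_pos by simp
    qed
    then have "(\<Sum>q=1..m + 1. \<Sum>j<?n. prob m 0 (Busy q j) * (- (lam * H)))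
      \<le> (\<Sum>q=1..m + 1. \<Sum>j<?n. prob m 0 (Busy q j) *
        (if q \<le> m then (lam - (1 - p)) * (real m + 1 - real q) +
          lam * (h j * ((real m + 1 - real (q + 1)) - (real m + 1 - real q)))
        else - (1 - p) * (real m + 1 - real (m + 1))))"
      by (intro sum_mono mult_left_mono) auto
    then have "lam * idle m 0 * (real m + 1 - real 1) \<le> (1 - idle m 0) * (lam * H)"
      using stationary_level_test[OF h, of m "\<lambda>q. real m + 1 - real q"]
      unfolding sum_distrib_right[symmetric] busy by linarith
    also have "\<dots> \<le> 1 * (lam * H)"
      using lam_pos H0 by (intro mult_right_mono) auto
    finally have "lam * (real m * idle m 0) \<le> lam * H" by (simp add: mult_ac)
    then have "real m * idle m 0 \<le> H" using lam_pos by simp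
    also have "H \<le> real m * g" using m g by (simp add: pos_divide_le_eq)
    finally have le: "real m * idle m 0 \<le> real m * g" .
    show ?thesis
    proof (cases "m = 0")
      \<comment> \<open>Nothing can be cancelled for \<open>m = 0\<close>, but then
        \<open>H \<le> 0\<close>, so every \<open>h j\<close> is zero, against mean one.\<close>
      case True
      then have "H = 0" using m g H0 by (simp add: pos_divide_le_eq)
      then have "h j = 0" if "j < ?n" for j using H[OF that] by simp
      then show ?thesis using h(2) by simp
    next
      case False
      then have "idle m 0 \<le> g" using le by simp
      then show ?thesis unfolding g_def by blast
    qed
  qed
qed

section \<open>Existence of the cavity parameters and queues with one place\<close>

lemma cavity_params_exist:
  assumes "0 < p" "p < lam" "lam < 1"
  obtains m \<omega> where "0 \<le> \<omega>" "idle m \<omega> = (1 - lam) / (1 - p)"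
proof -
  have "(1 - lam) / (1 - p) < 1" using assms p_less_1 by simp
  then show ?thesis using idle_small[OF assms(1,3)] idle_surj that by metis
qed

text \<open>With \<open>m = 0\<close> the queue length is the indicator of a busy system, so its law
  depends on the idle probability alone.\<close>

lemma queue_length_one_place:
  assumes "0 \<le> \<omega>"
  shows "map_pmf queue_length (rp_stationary lam p \<alpha> S 0 \<omega>) = map_pmf of_bool (bernoulli_pmf (1 - idle 0 \<omega>))"
proof -
  let ?\<pi> = "rp_stationary lam p \<alpha> S 0 \<omega>"
  have "set_pmf ?\<pi> \<subseteq> states 0"
    using rp_stationary[OF assms] by (simp add: stationary_distribution_def)
  then have "map_pmf queue_length ?\<pi> = map_pmf (\<lambda>x. of_bool (x \<noteq> Empty)) ?\<pi>"
    by (intro map_pmf_cong) (auto simp: rp_states_def)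
  also have "\<dots> = map_pmf of_bool (map_pmf (\<lambda>x. x \<noteq> Empty) ?\<pi>)"
    by (simp add: pmf.map_comp comp_def)
  also have "map_pmf (\<lambda>x. x \<noteq> Empty) ?\<pi> = bernoulli_pmf (1 - idle 0 \<omega>)"
  proof (rule pmf_eqI)
    have "pmf (map_pmf (\<lambda>x. x \<noteq> Empty) ?\<pi>) False = measure ?\<pi> {Empty}"
      by (auto simp: pmf_map intro!: arg_cong[of _ _ "measure ?\<pi>"])
    then have F: "pmf (map_pmf (\<lambda>x. x \<noteq> Empty) ?\<pi>) False = idle 0 \<omega>"
      by (simp add: measure_pmf_single)
    fix b
    show "pmf (map_pmf (\<lambda>x. x \<noteq> Empty) ?\<pi>) b = pmf (bernoulli_pmf (1 - idle 0 \<omega>)) b"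
      using F pmf_False_conv_True[of "map_pmf (\<lambda>x. x \<noteq> Empty) ?\<pi>"]
      by (cases b) (simp_all add: pmf_le_1)
  qed
  finally show ?thesis .
qed

end

section \<open>Bursty job sizes\<close>

text \<open>Together with \<open>bursty_mat\<close> a hyperexponential distribution: exponential of
  mean \<open>\<epsilon>\<close> with probability \<open>1 - \<epsilon>\<close>, and otherwise
  exponential of mean \<open>(1 - \<epsilon> + \<epsilon>\<^sup>2) / \<epsilon>\<close>, which makes
  the overall mean one.\<close>

definition bursty_vec :: "real \<Rightarrow> real vec" where
  "bursty_vec \<epsilon> = vec 2 (\<lambda>j. if j = 0 then 1 - \<epsilon> else \<epsilon>)"

definition bursty_mat :: "real \<Rightarrow> real mat" where
  "bursty_mat \<epsilon> = mat 2 2 (\<lambda>(i, j). if i \<noteq> j then 0 else if i = 0 then - (1 / \<epsilon>) else - (\<epsilon> / (1 - \<epsilon> + \<epsilon>\<^sup>2)))"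

lemma sum_lessThan_2: "(\<Sum>i<2. f i) = f 0 + f (1 :: nat)"
  by (simp add: numeral_2_eq_2)

lemma bursty_denominator_pos: "0 < 1 - \<epsilon> + \<epsilon>\<^sup>2" for \<epsilon> :: real
proof -
  have "1 - \<epsilon> + \<epsilon>\<^sup>2 = (\<epsilon> - 1 / 2)\<^sup>2 + 3 / 4" by (simp add: power2_eq_square algebra_simps)
  then show ?thesis by (simp add: add_nonneg_pos)
qed

lemma bursty_mean_one:
  assumes "0 < \<epsilon>" "\<epsilon> < 1"
  shows "mean_one_phase_type (bursty_vec \<epsilon>) (bursty_mat \<epsilon>)"
proof -
  let ?d = "1 - \<epsilon> + \<epsilon>\<^sup>2"
  have d: "0 < ?d" by (rule bursty_denominator_pos)
  define B where "B = mat 2 2 (\<lambda>(i, j). if i \<noteq> j then 0 else if i = (0::nat) then - \<epsilon> else - (?d / \<epsilon>))"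
  have less2: "i < 2 \<longleftrightarrow> i = 0 \<or> i = 1" for i :: nat by auto
  have "(\<epsilon> - 1 - \<epsilon>\<^sup>2) / ?d = -1" using d by (simp add: divide_eq_eq)
  then have "bursty_mat \<epsilon> * B = 1\<^sub>m 2" "B * bursty_mat \<epsilon> = 1\<^sub>m 2"
    using assms d
    by (auto intro!: eq_matI simp: bursty_mat_def B_def scalar_prod_def atLeast0LessThan sum_lessThan_2 less2)
  then have inv: "invertible_mat (bursty_mat \<epsilon>)"
    unfolding invertible_mat_def inverts_mat_def
    by (intro conjI exI[of _ B]) (auto simp: bursty_mat_def B_def square_mat.simps)
  have "probability_vec (bursty_vec \<epsilon>)"
    using assms by (auto simp: probability_vec_def bursty_vec_def sum_lessThan_2)
  moreover have "subgenerator_mat (bursty_mat \<epsilon>)"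
    using assms d by (auto simp: subgenerator_mat_def bursty_mat_def square_mat.simps sum_lessThan_2 less2)
  ultimately have ph: "phase_type (bursty_vec \<epsilon>) (bursty_mat \<epsilon>)"
    using inv by (simp add: phase_type_def bursty_vec_def bursty_mat_def)
  have "ph_mean (bursty_vec \<epsilon>) (bursty_mat \<epsilon>)
      = (\<Sum>j<dim_vec (bursty_vec \<epsilon>). bursty_vec \<epsilon> $ j * (if j = 0 then \<epsilon> else ?d / \<epsilon>))"
    using assms d
    by (intro ph_mean_eq[OF ph]) (auto simp: bursty_vec_def bursty_mat_def sum_lessThan_2 less2)
  also have "\<dots> = 1"
    using assms by (simp add: bursty_vec_def sum_lessThan_2 power2_eq_square field_simps)
  finally show ?thesis using ph by (simp add: mean_one_phase_type_def)
qed

text \<open>Comparison with the test function that charges a mean residual service time to the job in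
  service, and \<open>2 / (1 - p)\<close> for each job waiting behind a short one: while a short job is served the
  queue is likely to lose that charge before the next arrival.\<close>

lemma bursty_idle_bound:
  fixes lam p \<epsilon> :: real and m :: nat
  assumes lam: "0 < lam" and p: "p < 1" and \<epsilon>: "0 < \<epsilon>" "\<epsilon> \<le> 1 / 2" "2 * lam * \<epsilon> \<le> 1 - p"
    and idle: "I = pmf (rp_stationary lam p (bursty_vec \<epsilon>) (bursty_mat \<epsilon>) m 0) Empty"
  shows "(1 - 4 * (real m + 1) * \<epsilon>) * (1 - I) \<le> lam * I * (1 / (1 - p) + 2 * lam * \<epsilon> / (1 - p)\<^sup>2)"
proof -
  let ?d = "1 - \<epsilon> + \<epsilon>\<^sup>2"
  define \<mu> where "\<mu> = \<epsilon> / ?d"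
  define c where "c = 1 - p"
  \<comment> \<open>Half of \<open>\<kappa>\<close> pays for the mean service time
    \<open>1 / c\<close> of the next job; the other half, collected when a short job ends at rate
    \<open>c / \<epsilon>\<close>, outweighs the arrival term
    \<open>lam * \<kappa> \<le> 1 / \<epsilon>\<close>. At level 1 no waiting job pays, and
    \<open>\<theta>\<close> covers that term. \<open>\<eta>\<close> bounds the error in the long
    phase.\<close>
  define \<kappa> where "\<kappa> = 2 / c"
  define \<theta> where "\<theta> = 2 * lam * \<epsilon> / c\<^sup>2"
  define \<eta> where "\<eta> = 4 * (real m + 1) * \<epsilon>"
  have c: "0 < c" using p by (simp add: c_def)
  have d: "1 / 2 \<le> ?d" using \<epsilon>(2) zero_le_power2[of \<epsilon>] by linarith
  have \<mu>: "0 < \<mu>" "\<mu> \<le> 2 * \<epsilon>"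
    using d \<epsilon> by (auto simp: \<mu>_def divide_le_eq intro!: divide_pos_pos)
  have \<kappa>: "0 < \<kappa>" "c * \<kappa> = 2" using c by (auto simp: \<kappa>_def)
  have \<theta>: "0 < \<theta>" "c * \<theta> = \<epsilon> * (lam * \<kappa>)"
    using c lam \<epsilon> by (auto simp: \<theta>_def \<kappa>_def power2_eq_square)
  have "2 * lam * \<epsilon> \<le> c" using \<epsilon>(3) by (simp add: c_def)
  then have c\<theta>: "c * \<theta> \<le> 1"
    unfolding \<theta>(2) \<kappa>_def using c by (simp add: divide_le_eq mult_ac)
  interpret pooling_queue lam p "bursty_vec \<epsilon>" "bursty_mat \<epsilon>"
    using lam p \<epsilon> bursty_mean_one by unfold_locales auto
  have dim: "dim_vec (bursty_vec \<epsilon>) = 2" by (simp add: bursty_vec_def)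
  have alpha: "bursty_vec \<epsilon> $ 0 = 1 - \<epsilon>" "bursty_vec \<epsilon> $ Suc 0 = \<epsilon>"
    by (simp_all add: bursty_vec_def)
  have S: "bursty_mat \<epsilon> $$ (0, 0) = - (1 / \<epsilon>)" "bursty_mat \<epsilon> $$ (Suc 0, Suc 0) = - \<mu>"
    "bursty_mat \<epsilon> $$ (0, Suc 0) = 0" "bursty_mat \<epsilon> $$ (Suc 0, 0) = 0"
    by (simp_all add: bursty_mat_def \<mu>_def)
  have ex: "exit_vec (bursty_mat \<epsilon>) $ 0 = 1 / \<epsilon>" "exit_vec (bursty_mat \<epsilon>) $ Suc 0 = \<mu>"
    using S exit_vec_eq by (simp_all add: dim sum_lessThan_2)
  \<comment> \<open>In the long phase the value does not depend on \<open>q\<close>, so arrivals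
    leave it unchanged. The jobs waiting behind a long one enter only at its completion, whose rate
    is of order \<open>\<epsilon>\<close>.\<close>
  define U where "U q j = (if q = 0 then 0 else if j = 0 then \<epsilon> / c + \<kappa> * (real q - 1) + \<theta> else 1 / \<mu> / c)"
    for q j :: nat
  define A where "A q = (\<Sum>i<2. bursty_vec \<epsilon> $ i * U q i)" for q
  have A0: "A 0 = 0" by (simp add: A_def U_def)
  have A: "A q = 1 / c + (1 - \<epsilon>) * (\<kappa> * (real q - 1) + \<theta>)" if "1 \<le> q" for q
  proof -
    have "(1 - \<epsilon>) * (\<epsilon> / c) + \<epsilon> * (1 / \<mu> / c) = ((1 - \<epsilon>) * \<epsilon> + \<epsilon> * (1 / \<mu>)) / c"
      by (simp add: add_divide_distrib)
    also have "\<epsilon> * (1 / \<mu>) = ?d" using \<epsilon> d by (simp add: \<mu>_def)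
    also have "(1 - \<epsilon>) * \<epsilon> + ?d = 1" by (simp add: power2_eq_square algebra_simps)
    finally show ?thesis
      using that by (simp add: A_def sum_lessThan_2 alpha U_def algebra_simps)
  qed
  have A_le: "A q \<le> 1 / c + (\<kappa> * (real q - 1) + \<theta>)" if "1 \<le> q" for q
    unfolding A[OF that] using that \<epsilon> \<kappa> \<theta>
    by (intro add_left_mono mult_left_le_one_le) (auto intro!: add_nonneg_nonneg)
  have drift: "drift m 0 U q j \<le> -1 + \<eta>" if q: "1 \<le> q" "q \<le> m + 1" and j: "j < 2" for q j
  proof (cases "j = 0")
    case True
    have fast: "drift m 0 U q j \<le> lam * \<kappa> + c * (1 / \<epsilon> * A (q - 1) - 1 / \<epsilon> * U q 0)"
    proof -
      have "drift m 0 U q j = (if q \<le> m then lam * \<kappa> else 0) + c * (1 / \<epsilon> * A (q - 1) - 1 / \<epsilon> * U q 0)"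
        using q by (simp add: True drift_def dim sum_lessThan_2 S ex U_def A_def c_def algebra_simps)
      then show ?thesis using lam \<kappa> by simp
    qed
    have "lam * \<kappa> + c * (1 / \<epsilon> * A (q - 1) - 1 / \<epsilon> * U q 0) \<le> -1"
    proof (cases "q = 1")
      case True
      have "c * (1 / \<epsilon> * A (q - 1) - 1 / \<epsilon> * U q 0) = - (1 + c * \<theta> / \<epsilon>)"
        using True \<epsilon> c by (simp add: A0 U_def field_simps)
      also have "c * \<theta> / \<epsilon> = lam * \<kappa>" using \<epsilon> by (simp add: \<theta>(2))
      finally show ?thesis by simp
    next
      case False
      then have q2: "2 \<le> q" using q by simp
      have "A (q - 1) \<le> 1 / c + (\<kappa> * (real q - 2) + \<theta>)"
        using A_le[of "q - 1"] q2 by (simp add: of_nat_diff)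
      then have "A (q - 1) - U q 0 \<le> 1 / c - \<epsilon> / c - \<kappa>"
        using q by (simp add: U_def algebra_simps)
      then have "c * (A (q - 1) - U q 0) \<le> c * (1 / c - \<epsilon> / c - \<kappa>)"
        using c by (intro mult_left_mono) auto
      also have "\<dots> = - 1 - \<epsilon>" using c \<kappa>(2) by (simp add: algebra_simps)
      finally have "c * (A (q - 1) - U q 0) / \<epsilon> \<le> (- 1 - \<epsilon>) / \<epsilon>"
        using \<epsilon> by (intro divide_right_mono) auto
      also have "(- 1 - \<epsilon>) / \<epsilon> = - (1 / \<epsilon>) - 1" using \<epsilon> by (simp add: field_simps)
      finally have "c * (1 / \<epsilon> * A (q - 1) - 1 / \<epsilon> * U q 0) \<le> - (1 / \<epsilon>) - 1"
        by (simp add: right_diff_distrib diff_divide_distrib)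
      moreover have "lam * \<kappa> \<le> 1 / \<epsilon>"
        using \<epsilon> c by (simp add: \<kappa>_def field_simps c_def)
      ultimately show ?thesis by simp
    qed
    moreover have "0 \<le> \<eta>" using \<epsilon> by (simp add: \<eta>_def)
    ultimately show ?thesis using fast by linarith
  next
    case False
    then have j1: "j = Suc 0" using j by simp
    have slow: "drift m 0 U q j = -1 + \<mu> * (c * A (q - 1))"
      using q c \<mu> by (simp add: j1 drift_def dim sum_lessThan_2 S ex U_def A_def c_def[symmetric] field_simps)
    have "c * A (q - 1) \<le> 2 * (real m + 1)"
    proof (cases "q = 1")
      case True
      then show ?thesis by (simp add: A0)
    next
      case False
      then have q2: "2 \<le> q" using q by simp
      have "c * A (q - 1) \<le> c * (1 / c + (\<kappa> * (real q - 2) + \<theta>))"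
        using A_le[of "q - 1"] q2 c by (intro mult_left_mono) (auto simp: of_nat_diff)
      also have "\<dots> = 1 + (c * \<kappa>) * (real q - 2) + c * \<theta>"
        using c by (simp add: algebra_simps)
      also have "\<dots> \<le> 2 * (real m + 1)"
        using c\<theta> q unfolding \<kappa>(2) by simp
      finally show ?thesis .
    qed
    then have "\<mu> * (c * A (q - 1)) \<le> \<mu> * (2 * (real m + 1))"
      using \<mu> by (intro mult_left_mono) auto
    also have "\<dots> \<le> (2 * \<epsilon>) * (2 * (real m + 1))"
      using \<mu> by (intro mult_right_mono) auto
    also have "\<dots> = \<eta>" by (simp add: \<eta>_def)
    finally show ?thesis using slow by simp
  qed
  have "(\<Sum>q=1..m + 1. \<Sum>j<2. prob m 0 (Busy q j) * drift m 0 U q j)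
      \<le> (\<Sum>q=1..m + 1. \<Sum>j<2. prob m 0 (Busy q j) * (-1 + \<eta>))"
    using drift by (intro sum_mono mult_left_mono) auto
  also have "\<dots> = (1 - I) * (-1 + \<eta>)"
    unfolding sum_distrib_right[symmetric] using sum_Busy[OF order_refl, of m] by (simp add: dim idle)
  finally have "(1 - \<eta>) * (1 - I) \<le> I * (lam * A 1)"
    using stationary_drift[OF rp_stationary[OF order_refl], of U 0 m]
    by (simp add: U_def A_def dim idle algebra_simps)
  also have "\<dots> = lam * I * A 1" by simp
  also have "\<dots> \<le> lam * I * (1 / c + \<theta>)"
    using A_le[of 1] lam by (intro mult_left_mono) (auto simp: idle)
  finally show ?thesis by (simp add: \<eta>_def \<theta>_def c_def)
qed

text \<open>At \<open>\<epsilon> = 0\<close> the inequality of \<open>bursty_idle_bound\<close>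
  would read \<open>1 - I \<le> I * \<rho>\<close>, that is, \<open>I\<close> is at least
  \<open>1 / (1 + \<rho>)\<close>. If \<open>I \<le> g\<close>, it would fail by at least
  \<open>\<delta>\<close>, while the error terms amount to at most
  \<open>\<epsilon> * C\<close>.\<close>

lemma bursty_idle_large:
  fixes lam p g :: real
  assumes lam: "0 < lam" and p: "p < 1" and g: "0 \<le> g" "g < 1 / (1 + lam / (1 - p))"
  shows "\<exists>\<epsilon>. 0 < \<epsilon> \<and> \<epsilon> < 1 \<and> g < pmf (rp_stationary lam p (bursty_vec \<epsilon>) (bursty_mat \<epsilon>) m 0) Empty"
proof -
  define \<rho> where "\<rho> = lam / (1 - p)"
  define \<delta> where "\<delta> = 1 - g - g * \<rho>"
  define C where "C = 4 * (real m + 1) + 2 * lam * lam / (1 - p)\<^sup>2"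
  have \<rho>: "0 < \<rho>" using lam p by (simp add: \<rho>_def)
  then have "g * (1 + \<rho>) < 1" using g by (simp add: \<rho>_def[symmetric] pos_less_divide_eq)
  then have \<delta>: "0 < \<delta>" by (simp add: \<delta>_def algebra_simps)
  have "0 \<le> g * \<rho>" using g \<rho> by simp
  then have g1: "g < 1" "\<delta> \<le> 1" using \<delta> g by (auto simp: \<delta>_def)
  have C_ge: "4 * (real m + 1) \<le> C" using lam by (simp add: C_def)
  moreover have "0 < 4 * (real m + 1)" by simp
  ultimately have "0 < C" by (rule less_le_trans[rotated])
  note C = C_ge this
  \<comment> \<open>The first two bounds meet the hypotheses of \<open>bursty_idle_bound\<close>;
    the third keeps \<open>\<epsilon> * C\<close> below \<open>\<delta>\<close>.\<close>
  define \<epsilon> where "\<epsilon> = min (1 / 2) (min ((1 - p) / (2 * lam)) (\<delta> / (2 * C)))"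
  have \<epsilon>: "0 < \<epsilon>" "\<epsilon> \<le> 1 / 2" "\<epsilon> \<le> (1 - p) / (2 * lam)" "\<epsilon> \<le> \<delta> / (2 * C)"
    using lam p \<delta> C by (auto simp: \<epsilon>_def)
  have "\<epsilon> * C \<le> \<delta> / 2" using \<epsilon>(4) C by (simp add: field_simps)
  then have \<epsilon>C: "\<epsilon> * C < \<delta>" using \<delta> by linarith
  have "4 * (real m + 1) * \<epsilon> \<le> C * \<epsilon>" using C \<epsilon> by (intro mult_right_mono) auto
  then have \<eta>: "4 * (real m + 1) * \<epsilon> \<le> 1" using \<epsilon>C g1 by (simp add: mult.commute)
  define I where "I = pmf (rp_stationary lam p (bursty_vec \<epsilon>) (bursty_mat \<epsilon>) m 0) Empty"
  have "g < I"
  proof (rule ccontr)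
    assume "\<not> g < I"
    then have I: "I \<le> g" by simp
    have "(1 - 4 * (real m + 1) * \<epsilon>) * (1 - g) \<le> (1 - 4 * (real m + 1) * \<epsilon>) * (1 - I)"
      using I \<eta> by (intro mult_left_mono) auto
    also have "\<dots> \<le> lam * I * (1 / (1 - p) + 2 * lam * \<epsilon> / (1 - p)\<^sup>2)"
      using lam p \<epsilon> I_def by (intro bursty_idle_bound) (auto simp: field_simps)
    also have "\<dots> \<le> lam * g * (1 / (1 - p) + 2 * lam * \<epsilon> / (1 - p)\<^sup>2)"
      using I lam p \<epsilon> by (intro mult_right_mono mult_left_mono add_nonneg_nonneg) auto
    also have "\<dots> = g * \<rho> + g * (\<epsilon> * (2 * lam * lam / (1 - p)\<^sup>2))"
      by (simp add: \<rho>_def algebra_simps)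
    also have "\<dots> \<le> g * \<rho> + 1 * (\<epsilon> * (2 * lam * lam / (1 - p)\<^sup>2))"
      using g1 \<epsilon> lam by (intro add_left_mono mult_right_mono) auto
    finally have "\<delta> \<le> 4 * (real m + 1) * \<epsilon> * (1 - g) + \<epsilon> * (2 * lam * lam / (1 - p)\<^sup>2)"
      by (simp add: \<delta>_def algebra_simps)
    also have "\<dots> \<le> 4 * (real m + 1) * \<epsilon> * 1 + \<epsilon> * (2 * lam * lam / (1 - p)\<^sup>2)"
      using g \<epsilon> by (intro add_right_mono mult_left_mono) auto
    also have "\<dots> = \<epsilon> * C" by (simp add: C_def algebra_simps)
    finally show False using \<epsilon>C by simp
  qed
  then show ?thesis using \<epsilon> by (intro exI[of _ \<epsilon>]) (auto simp: I_def)
qed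

section \<open>Unbounded queues versus insensitivity\<close>

theorem proposition7p2:
  fixes lam p :: real
  assumes "0 < p" and "p < lam" and "lam < 1"
  shows
    "(1 / (1 + lam / (1 - p)) > (1 - lam) / (1 - p) \<longrightarrow>
        (\<forall>n::nat. \<exists>\<alpha> S. mean_one_phase_type \<alpha> S \<and> cavity_max_queue_length lam p \<alpha> S > n)) \<and>
     (\<not> 1 / (1 + lam / (1 - p)) > (1 - lam) / (1 - p) \<longrightarrow>
        (\<forall>\<alpha> S \<alpha>' S'. mean_one_phase_type \<alpha> S \<and> mean_one_phase_type \<alpha>' S' \<longrightarrow>
           cavity_queue_length lam p \<alpha> S = cavity_queue_length lam p \<alpha>' S') \<and>
        (\<forall>\<alpha> S. mean_one_phase_type \<alpha> S \<longrightarrow> cavity_max_queue_length lam p \<alpha> S = 1))"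
proof -
  define g where "g = (1 - lam) / (1 - p)"
  have lam: "0 < lam" and p: "p < 1" using assms by auto
  have g: "0 \<le> g" "g < 1" using assms p by (auto simp: g_def)
  have "\<exists>\<alpha> S. mean_one_phase_type \<alpha> S \<and> n < cavity_max_queue_length lam p \<alpha> S"
    if large: "g < 1 / (1 + lam / (1 - p))" for n
  proof -
    obtain \<epsilon> where \<epsilon>: "0 < \<epsilon>" "\<epsilon> < 1"
      "g < pmf (rp_stationary lam p (bursty_vec \<epsilon>) (bursty_mat \<epsilon>) n 0) Empty"
      using bursty_idle_large[OF lam p g(1) large] by blast
    interpret pooling_queue lam p "bursty_vec \<epsilon>" "bursty_mat \<epsilon>"
      using lam p \<epsilon> bursty_mean_one by unfold_locales auto
    obtain m \<omega> where m: "0 \<le> \<omega>" "idle m \<omega> = g"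
      using cavity_params_exist assms unfolding g_def by metis
    \<comment> \<open>Every pair with buffer index at most \<open>n\<close> has idle probability at
      least \<open>idle n 0\<close>, which exceeds the target.\<close>
    have "n < m"
    proof (rule ccontr)
      assume "\<not> n < m"
      then have "idle n 0 \<le> idle m \<omega>"
        using idle_less_level[of \<omega> 0 m n] idle_mono[of 0 \<omega> m] m by (cases "m = n") auto
      then show False using \<epsilon>(3) m by simp
    qed
    then show ?thesis
      using cavity_params_eqI[OF m(1)] m(2) mean_one
      by (intro exI[of _ "bursty_vec \<epsilon>"] exI[of _ "bursty_mat \<epsilon>"])
        (simp add: cavity_max_queue_length_def g_def)
  qed
  \<comment> \<open>Insensitivity is shown by exhibiting the law: it is Bernoulli with parameter
    \<open>1 - g\<close>, in which the job sizes do not occur.\<close>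
  moreover have "cavity_max_queue_length lam p \<alpha> S = 1 \<and>
      cavity_queue_length lam p \<alpha> S = map_pmf of_bool (bernoulli_pmf (1 - g))"
    if small: "\<not> g < 1 / (1 + lam / (1 - p))" and ph: "mean_one_phase_type \<alpha> S" for \<alpha> S
  proof -
    interpret pooling_queue lam p \<alpha> S
      using lam p ph by unfold_locales
    have "idle 0 0 \<le> g" using small by (simp add: idle_0_0)
    then obtain \<omega> where \<omega>: "0 \<le> \<omega>" "idle 0 \<omega> = g"
      using idle_surj[OF g(2)] by blast
    then have "cavity_params lam p \<alpha> S = (0, \<omega>)"
      by (intro cavity_params_eqI) (simp_all add: g_def)
    then show ?thesis
      using queue_length_one_place[OF \<omega>(1)] \<omega>(2)
      by (simp add: cavity_max_queue_length_def cavity_queue_length_def cavity_stationary_def)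
  qed
  ultimately show ?thesis unfolding g_def[symmetric] by auto
qed

end
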